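(* Let $a,d\ge 1$ be integers and let $k$ be an admissible field. Let $\mathbb W=\mathbb A^d$, let $\mu:\mathbb W\to\mathbb A$ be $\mu(x^1,\dots,x^d)=\prod_{j=1}^d x^j$, and for $n\ge 1$ let $\mathbb V_n=\mathbb W^n$, $P_n:\mathbb V_n\to\mathbb A$, $P_n(w_1,\dots,w_n)=\sum_{i=1}^n\mu(w_i)$, and $\mathbb X_n=\{v\in\mathbb V_n: P_n(v)=0\}$. Then: (1) $r(P_n)\ge n/d$. (2) The hypersurface $\mathbb X_n\subset\mathbb V_n$ has property $\star_a$; that is, for every finite extension $l/k$, every weakly polynomial function of degree $\le a$ on $\mathbb X_n(l)\subset\mathbb V_n(l)$ (with values in $l$) is the restriction of a polynomial function of degree $\le a$ on $\mathbb V_n(l)$.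
   Context: Admissible field: given integers $a,d\ge 1$, a field $k$ is admissible if $|k|>ad$, $k$ contains a root of unity of order $m>2a$, and either $\mathrm{char}(k)=0$ or $\mathrm{char}(k)>d$. Weakly polynomial: for an $l$-vector space $V$ and a subset $X\subset V$, a function $f:X\to l$ is weakly polynomial of degree $\le a$ if for every affine subspace $L\subset X$ (over $l$) the restriction $f|_L$ is a polynomial of degree $\le a$. Rank: $r(P)=r_k(P)$ is the minimal number $r$ such that $P=\sum_{i=1}^r Q_iR_i$ with $Q_i,R_i$ polynomials over $k$ of degrees strictly smaller than $\deg P$ ($=\infty$ if there is no such representation). *)

theory Defs
  imports
    "HOL-Library.Poly_Mapping"
    "HOL-Library.Function_Algebras"
    "HOL-Library.Extended_Real"
begin

text \<open>
  Formal polynomials with coefficients in \<open>'a\<close> and variables from \<open>'v\<close>: finitely supported maps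
  from exponent vectors to coefficients, with the ring structure of \<open>HOL-Library.Poly_Mapping\<close>.
\<close>

type_synonym ('v, 'a) mpoly = "('v \<Rightarrow>\<^sub>0 nat) \<Rightarrow>\<^sub>0 'a"

definition mvar :: "'v \<Rightarrow> ('v, 'a::comm_ring_1) mpoly" where
  "mvar x = Poly_Mapping.single (Poly_Mapping.single x 1) 1"

definition mvars :: "('v, 'a::zero) mpoly \<Rightarrow> 'v set" where
  "mvars p = (\<Union>m\<in>Poly_Mapping.keys p. Poly_Mapping.keys m)"

text \<open>The total degree; the zero polynomial gets degree \<open>0\<close>.\<close>

definition total_degree :: "('v, 'a::zero) mpoly \<Rightarrow> nat" where
  "total_degree p =
     Max (insert 0 ((\<lambda>m. \<Sum>x\<in>Poly_Mapping.keys m. Poly_Mapping.lookup m x) ` Poly_Mapping.keys p))"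

definition mpoly_eval :: "('v \<Rightarrow> 'a::comm_ring_1) \<Rightarrow> ('v, 'a) mpoly \<Rightarrow> 'a" where
  "mpoly_eval v p =
     (\<Sum>m\<in>Poly_Mapping.keys p. Poly_Mapping.lookup p m *
        (\<Prod>x\<in>Poly_Mapping.keys m. v x ^ Poly_Mapping.lookup m x))"

text \<open>
  The rank of a polynomial in the variables \<open>I\<close>; as \<open>Inf {} = \<infinity>\<close> in \<open>enat\<close>, it is infinite if there
  is no representation. Only the degrees of the individual factors are bounded, not the degrees of
  the products.
\<close>

definition poly_rank :: "'v set \<Rightarrow> ('v, 'a::comm_ring_1) mpoly \<Rightarrow> enat" where
  "poly_rank I P = Inf {enat r | r. \<exists>Q R :: nat \<Rightarrow> ('v, 'a) mpoly.
     (\<forall>i<r. mvars (Q i) \<subseteq> I \<and> mvars (R i) \<subseteq> I \<and>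
            total_degree (Q i) < total_degree P \<and> total_degree (R i) < total_degree P) \<and>
     P = (\<Sum>i<r. Q i * R i)}"

text \<open>
  The \<open>l\<close>-points of the affine space with coordinates indexed by \<open>I\<close>, as functions
  vanishing outside \<open>I\<close>.
\<close>

definition affine_points :: "'v set \<Rightarrow> ('v \<Rightarrow> 'l::zero) set" where
  "affine_points I = {v. \<forall>x. x \<notin> I \<longrightarrow> v x = 0}"

definition is_affine_subspace :: "('v \<Rightarrow> 'l::field) set \<Rightarrow> bool" where
  "is_affine_subspace L \<longleftrightarrow>
     (\<exists>v U. module.subspace (\<lambda>c w. \<lambda>x. c * w x) U \<and> L = (\<lambda>u. v + u) ` U)"

definition polynomial_on ::
  "nat \<Rightarrow> 'v set \<Rightarrow> ('v \<Rightarrow> 'l::comm_ring_1) set \<Rightarrow> (('v \<Rightarrow> 'l) \<Rightarrow> 'l) \<Rightarrow> bool" where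
  "polynomial_on a I S f \<longleftrightarrow>
     (\<exists>p. mvars p \<subseteq> I \<and> total_degree p \<le> a \<and> (\<forall>v\<in>S. f v = mpoly_eval v p))"

definition weakly_polynomial ::
  "nat \<Rightarrow> 'v set \<Rightarrow> ('v \<Rightarrow> 'l::field) set \<Rightarrow> (('v \<Rightarrow> 'l) \<Rightarrow> 'l) \<Rightarrow> bool" where
  "weakly_polynomial a I X f \<longleftrightarrow>
     (\<forall>L. is_affine_subspace L \<and> L \<subseteq> X \<longrightarrow> polynomial_on a I L f)"

text \<open>A finite extension \<open>l/k\<close>, given by the embedding of \<open>k\<close> into \<open>l\<close>.\<close>

definition finite_field_extension :: "('k::field \<Rightarrow> 'l::field) \<Rightarrow> bool" where
  "finite_field_extension emb \<longleftrightarrow>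
     emb 1 = 1 \<and>
     (\<forall>x y. emb (x + y) = emb x + emb y) \<and>
     (\<forall>x y. emb (x * y) = emb x * emb y) \<and>
     (\<exists>B. finite B \<and> module.span (\<lambda>c y. emb c * y) B = UNIV)"

text \<open>The \<open>l\<close>-points of the hypersurface \<open>P = 0\<close>.\<close>

definition hypersurface_points ::
  "('k::field \<Rightarrow> 'l::field) \<Rightarrow> 'v set \<Rightarrow> ('v, 'k) mpoly \<Rightarrow> ('v \<Rightarrow> 'l) set" where
  "hypersurface_points emb I P =
     {v \<in> affine_points I. mpoly_eval v (Poly_Mapping.map emb P) = 0}"

text \<open>
  Property \<open>\<star>\<^sub>a\<close> of the hypersurface \<open>P = 0\<close>, for the extensions \<open>l/k\<close> whose underlying
  type is \<open>'l\<close>. A definition cannot quantify over types, so that all finite extensions are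
  covered by leaving \<open>'l\<close> arbitrary where this predicate is used.
\<close>

definition star_property ::
  "'l::field itself \<Rightarrow> nat \<Rightarrow> 'v set \<Rightarrow> ('v, 'k::field) mpoly \<Rightarrow> bool" where
  "star_property _ a I P \<longleftrightarrow>
     (\<forall>emb :: 'k \<Rightarrow> 'l. finite_field_extension emb \<longrightarrow>
        (\<forall>f. weakly_polynomial a I (hypersurface_points emb I P) f \<longrightarrow>
             (\<exists>g. polynomial_on a I (affine_points I) g \<and>
                  (\<forall>v\<in>hypersurface_points emb I P. f v = g v))))"

definition root_of_unity_of_order :: "nat \<Rightarrow> 'k::field \<Rightarrow> bool" where
  "root_of_unity_of_order m z \<longleftrightarrow> 0 < m \<and> z ^ m = 1 \<and> (\<forall>j. 0 < j \<and> j < m \<longrightarrow> z ^ j \<noteq> 1)"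

definition admissible :: "'k::field itself \<Rightarrow> nat \<Rightarrow> nat \<Rightarrow> bool" where
  "admissible _ a d \<longleftrightarrow>
     (infinite (UNIV :: 'k set) \<or> card (UNIV :: 'k set) > a * d) \<and>
     (\<exists>m (z :: 'k). m > 2 * a \<and> root_of_unity_of_order m z) \<and>
     (CHAR('k) = 0 \<or> CHAR('k) > d)"

text \<open>
  The coordinates on \<open>V\<^sub>n = W\<^sup>n\<close> with \<open>W = A\<^sup>d\<close>: the pair \<open>(i, j)\<close>
  stands for the \<open>j\<close>-th coordinate of \<open>w\<^sub>i\<close> (indices counted from \<open>0\<close>).
\<close>

definition coords :: "nat \<Rightarrow> nat \<Rightarrow> (nat \<times> nat) set" where
  "coords d n = {..<n} \<times> {..<d}"

definition Pn :: "nat \<Rightarrow> nat \<Rightarrow> (nat \<times> nat, 'k::field) mpoly" where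
  "Pn d n = (\<Sum>i<n. \<Prod>j<d. mvar (i, j))"

end

theory Submission
  imports Defs "HOL-Computational_Algebra.Polynomial" "HOL-Library.FuncSet"
begin

text \<open>
  Rank: if \<open>P = \<Sum> Q\<^sub>i R\<^sub>i\<close> with \<open>r\<close> terms, then by the Leibniz rule the partial derivatives of \<open>P\<close> lie
  in the ideal generated by the \<open>2 r (d - 1)\<close> homogeneous components of degrees \<open>1, \<dots>, d - 1\<close> of the
  \<open>Q\<^sub>i\<close> and \<open>R\<^sub>i\<close>.  The derivatives of \<open>P\<^sub>n\<close> are monomials that cut out a locus of codimension \<open>2 n\<close>, and
  a count of monomials of bounded degree gives \<open>2 n \<le> 2 r (d - 1)\<close> without dimension theory.

  Extension: the torus of all \<open>t\<close> with \<open>\<Prod>\<^sub>j t\<^sub>i\<^sub>j = 1\<close> for every \<open>i\<close> acts on the hypersurface.  Along each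
  one-parameter subgroup a weakly polynomial function is a Laurent polynomial with exponents in
  \<open>[-a, a]\<close>; as there are more than \<open>2 a\<close> nonzero scalars, its coefficients are linear combinations of
  translates of the function.  So one may assume that \<open>f\<close> is an eigenfunction of weight \<open>\<theta>\<close>.  Such an \<open>f\<close> is
  determined by its values on the affine subspace of points with at most one coordinate different
  from \<open>1\<close> in every row: \<open>f(v) = v\<^sup>\<theta> h(\<mu>(w\<^sub>1), \<dots>, \<mu>(w\<^sub>n))\<close> with \<open>h\<close> a polynomial of degree at most \<open>a\<close> on
  \<open>\<Sum> c\<^sub>i = 0\<close>.  Restricting \<open>f\<close> to lines on which equally many coordinates of every row are scaled bounds
  the degrees: a component of degree \<open>k\<close> of \<open>h\<close> can only be present if \<open>|\<theta>| + d k \<le> a\<close>.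
\<close>

subsection \<open>Monomials and total degree\<close>

definition monom_deg :: "('v \<Rightarrow>\<^sub>0 nat) \<Rightarrow> nat" where
  "monom_deg m = (\<Sum>x\<in>Poly_Mapping.keys m. Poly_Mapping.lookup m x)"

lemma monom_deg_superset:
  assumes "finite A" "Poly_Mapping.keys m \<subseteq> A"
  shows "monom_deg m = (\<Sum>x\<in>A. Poly_Mapping.lookup m x)"
  unfolding monom_deg_def using assms
  by (intro sum.mono_neutral_left) (auto simp: in_keys_iff)

lemma monom_deg_add: "monom_deg (m + m') = monom_deg m + monom_deg m'"
proof -
  let ?A = "Poly_Mapping.keys m \<union> Poly_Mapping.keys m'"
  have "monom_deg (m + m') = (\<Sum>x\<in>?A. Poly_Mapping.lookup (m + m') x)"
    by (intro monom_deg_superset) (auto simp: keys_add)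
  also have "\<dots> = monom_deg m + monom_deg m'"
    by (simp add: lookup_add sum.distrib monom_deg_superset[of ?A])
  finally show ?thesis .
qed

lemma monom_deg_0 [simp]: "monom_deg 0 = 0"
  by (simp add: monom_deg_def)

lemma monom_deg_single [simp]: "monom_deg (Poly_Mapping.single x k) = k"
  by (simp add: monom_deg_def)

lemma monom_deg_sum: "monom_deg (sum f A) = (\<Sum>x\<in>A. monom_deg (f x))"
  by (induction A rule: infinite_finite_induct) (auto simp: monom_deg_add)

lemma keys_sum_subset: "Poly_Mapping.keys (sum f A) \<subseteq> (\<Union>x\<in>A. Poly_Mapping.keys (f x))"
proof (induction A rule: infinite_finite_induct)
  case (insert x A)
  then show ?case using keys_add[of "f x" "sum f A"] by auto
qed auto

lemma total_degree_le_iff: "total_degree p \<le> a \<longleftrightarrow> (\<forall>m\<in>Poly_Mapping.keys p. monom_deg m \<le> a)"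
  unfolding total_degree_def monom_deg_def[symmetric] by (subst Max_le_iff) auto

lemma total_degree_less_imp:
  "total_degree p < d \<Longrightarrow> m \<in> Poly_Mapping.keys p \<Longrightarrow> monom_deg m < d"
  using total_degree_le_iff[of p "total_degree p"] by force

lemma mvars_subset_iff: "mvars p \<subseteq> I \<longleftrightarrow> (\<forall>m\<in>Poly_Mapping.keys p. Poly_Mapping.keys m \<subseteq> I)"
  unfolding mvars_def by blast

lemma mpoly_expand:
  assumes "finite A" "Poly_Mapping.keys p \<subseteq> A"
  shows "p = (\<Sum>m\<in>A. Poly_Mapping.single m (Poly_Mapping.lookup p m))"
proof (rule poly_mapping_eqI)
  fix k
  have "Poly_Mapping.lookup (\<Sum>m\<in>A. Poly_Mapping.single m (Poly_Mapping.lookup p m)) k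
     = (\<Sum>m\<in>A. if m = k then Poly_Mapping.lookup p m else 0)"
    unfolding lookup_sum by (intro sum.cong) (auto simp: lookup_single)
  also have "\<dots> = Poly_Mapping.lookup p k"
    using assms by (auto simp: sum.delta in_keys_iff)
  finally show "Poly_Mapping.lookup p k
     = Poly_Mapping.lookup (\<Sum>m\<in>A. Poly_Mapping.single m (Poly_Mapping.lookup p m)) k" by simp
qed

lemma Pn_conv_single:
  "Pn d n = (\<Sum>i<n. Poly_Mapping.single (\<Sum>j<d. Poly_Mapping.single (i, j) 1) (1::'k::field))"
proof -
  have "(\<Prod>j\<in>J. mvar (i, j)) = Poly_Mapping.single (\<Sum>j\<in>J. Poly_Mapping.single (i, j) 1) (1::'k)"
    for i :: nat and J :: "nat set"
    by (induction J rule: infinite_finite_induct) (auto simp: mvar_def mult_single)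
  then show ?thesis unfolding Pn_def by (simp only:)
qed

text \<open>Stated as an inequality because equality can fail for \<open>n = 0\<close>, where the
  polynomial is zero. It turns factors of degree below \<open>total_degree (Pn d n)\<close> into
  factors of degree below \<open>d\<close>.\<close>

lemma total_degree_Pn: "total_degree (Pn d n :: (nat \<times> nat, 'k::field) mpoly) \<le> d"
  and monom_deg_Pn: "m \<in> Poly_Mapping.keys (Pn d n :: (nat \<times> nat, 'k::field) mpoly) \<Longrightarrow> monom_deg m = d"
proof -
  have *: "monom_deg m = d" if "m \<in> Poly_Mapping.keys (Pn d n :: (nat \<times> nat, 'k::field) mpoly)" for m
  proof -
    have "m \<in> (\<Union>i\<in>{..<n}. Poly_Mapping.keys
        (Poly_Mapping.single (\<Sum>j<d. Poly_Mapping.single (i, j) 1) (1::'k)))"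
      using that keys_sum_subset unfolding Pn_conv_single by (rule set_rev_mp)
    then obtain i where "m = (\<Sum>j<d. Poly_Mapping.single (i, j) 1)" by auto
    then show ?thesis by (simp add: monom_deg_sum)
  qed
  then show "total_degree (Pn d n :: (nat \<times> nat, 'k::field) mpoly) \<le> d"
    by (auto simp: total_degree_le_iff)
  show "m \<in> Poly_Mapping.keys (Pn d n :: (nat \<times> nat, 'k::field) mpoly) \<Longrightarrow> monom_deg m = d"
    by (rule *)
qed

subsection \<open>Homogeneous components and derivatives\<close>

definition hpart :: "nat \<Rightarrow> ('v, 'a::comm_ring_1) mpoly \<Rightarrow> ('v, 'a) mpoly" where
  "hpart k = Poly_Mapping.mapp (\<lambda>m c. c when monom_deg m = k)"

lemma lookup_hpart:
  "Poly_Mapping.lookup (hpart k p) m = (if monom_deg m = k then Poly_Mapping.lookup p m else 0)"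
  by (auto simp: hpart_def lookup_mapp when_def in_keys_iff)

lemma keys_hpart: "Poly_Mapping.keys (hpart k p) = {m \<in> Poly_Mapping.keys p. monom_deg m = k}"
  by (auto simp: in_keys_iff lookup_hpart split: if_splits)

lemma hpart_sum: "hpart k (sum f A) = (\<Sum>x\<in>A. hpart k (f x))"
  by (rule poly_mapping_eqI) (auto simp: lookup_hpart lookup_sum)

lemma hpart_homogeneous:
  assumes "\<And>m. m \<in> Poly_Mapping.keys p \<Longrightarrow> monom_deg m = l"
  shows "hpart k p = (if l = k then p else 0)"
  by (rule poly_mapping_eqI) (use assms in \<open>auto simp: lookup_hpart in_keys_iff\<close>)

lemma sum_hpart:
  assumes "\<And>m. m \<in> Poly_Mapping.keys p \<Longrightarrow> monom_deg m < d"
  shows "p = (\<Sum>j<d. hpart j p)"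
proof (rule poly_mapping_eqI)
  fix m
  have "(\<Sum>j<d. Poly_Mapping.lookup (hpart j p) m)
      = (if monom_deg m < d then Poly_Mapping.lookup p m else 0)"
    by (simp add: lookup_hpart)
  also have "\<dots> = Poly_Mapping.lookup p m"
    using assms by (auto simp: in_keys_iff)
  finally show "Poly_Mapping.lookup p m = Poly_Mapping.lookup (\<Sum>j<d. hpart j p) m"
    by (simp add: lookup_sum)
qed

text \<open>The components of degree \<open>0\<close> drop out because neither factor has a component of degree \<open>d\<close>.\<close>

lemma hpart_mult:
  assumes "\<And>m. m \<in> Poly_Mapping.keys p \<Longrightarrow> monom_deg m < d"
    and "\<And>m. m \<in> Poly_Mapping.keys q \<Longrightarrow> monom_deg m < d"
  shows "hpart d (p * q) = (\<Sum>j\<in>{1..<d}. hpart j p * hpart (d - j) q)"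
proof -
  have *: "hpart d (hpart j p * hpart j' q) = (if j + j' = d then hpart j p * hpart j' q else 0)"
    for j j'
  proof (rule hpart_homogeneous)
    fix m assume "m \<in> Poly_Mapping.keys (hpart j p * hpart j' q)"
    then have "m \<in> {a + b | a b. a \<in> Poly_Mapping.keys (hpart j p) \<and> b \<in> Poly_Mapping.keys (hpart j' q)}"
      using keys_mult by (rule set_rev_mp)
    then show "monom_deg m = j + j'" by (auto simp: keys_hpart monom_deg_add)
  qed
  have "hpart d (p * q) = hpart d ((\<Sum>j<d. hpart j p) * (\<Sum>j<d. hpart j q))"
    using sum_hpart[of p d] sum_hpart[of q d] assms by simp
  also have "\<dots> = (\<Sum>j<d. \<Sum>j'<d. if j + j' = d then hpart j p * hpart j' q else 0)"
    by (simp add: sum_product hpart_sum *)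
  also have "\<dots> = (\<Sum>j<d. if 1 \<le> j then hpart j p * hpart (d - j) q else 0)"
  proof (intro sum.cong refl)
    fix j assume j: "j \<in> {..<d}"
    have "(\<Sum>j'<d. if j + j' = d then hpart j p * hpart j' q else 0)
        = (\<Sum>j'<d. if j' = d - j then hpart j p * hpart j' q else 0)"
      using j by (intro sum.cong) auto
    also have "\<dots> = (if 1 \<le> j then hpart j p * hpart (d - j) q else 0)"
      using j by (auto simp: sum.delta)
    finally show "(\<Sum>j'<d. if j + j' = d then hpart j p * hpart j' q else 0) = \<dots>" .
  qed
  also have "\<dots> = (\<Sum>j\<in>{1..<d}. hpart j p * hpart (d - j) q)"
    by (rule sum.mono_neutral_cong_right) auto
  finally show ?thesis .
qed

text \<open>If \<open>x\<close> does not occur in \<open>m\<close>, truncated subtraction leaves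
  \<open>m\<close> in place, but the coefficient is then \<open>0\<close>; so this is the formal
  partial derivative.\<close>

definition mpderiv :: "'v \<Rightarrow> ('v, 'a::comm_ring_1) mpoly \<Rightarrow> ('v, 'a) mpoly" where
  "mpderiv x p = (\<Sum>m\<in>Poly_Mapping.keys p.
     Poly_Mapping.single (m - Poly_Mapping.single x 1)
       (of_nat (Poly_Mapping.lookup m x) * Poly_Mapping.lookup p m))"

lemma mpderiv_superset:
  assumes "finite A" "Poly_Mapping.keys p \<subseteq> A"
  shows "mpderiv x p = (\<Sum>m\<in>A. Poly_Mapping.single (m - Poly_Mapping.single x 1)
       (of_nat (Poly_Mapping.lookup m x) * Poly_Mapping.lookup p m))"
  unfolding mpderiv_def using assms
  by (intro sum.mono_neutral_left) (auto simp: in_keys_iff)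

lemma mpderiv_single:
  "mpderiv x (Poly_Mapping.single m c)
     = Poly_Mapping.single (m - Poly_Mapping.single x 1) (of_nat (Poly_Mapping.lookup m x) * c)"
  by (cases "c = 0") (auto simp: mpderiv_def)

lemma mpderiv_add: "mpderiv x (p + q) = mpderiv x p + mpderiv x q"
proof -
  let ?A = "Poly_Mapping.keys p \<union> Poly_Mapping.keys q"
  have "mpderiv x (p + q) = (\<Sum>m\<in>?A. Poly_Mapping.single (m - Poly_Mapping.single x 1)
       (of_nat (Poly_Mapping.lookup m x) * Poly_Mapping.lookup (p + q) m))"
    by (intro mpderiv_superset) (auto simp: keys_add)
  also have "\<dots> = mpderiv x p + mpderiv x q"
    by (simp add: mpderiv_superset[of ?A] lookup_add algebra_simps single_add sum.distrib)
  finally show ?thesis .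
qed

lemma mpderiv_0 [simp]: "mpderiv x 0 = 0"
  by (simp add: mpderiv_def)

lemma mpderiv_sum: "mpderiv x (sum f A) = (\<Sum>y\<in>A. mpderiv x (f y))"
  by (induction A rule: infinite_finite_induct) (auto simp: mpderiv_add)

lemma mpderiv_mult: "mpderiv x (p * q) = p * mpderiv x q + q * mpderiv x p"
proof -
  let ?e = "Poly_Mapping.single x (1::nat)"
  have shift: "Poly_Mapping.single (m + l - ?e) (of_nat (Poly_Mapping.lookup m x) * c)
      = Poly_Mapping.single (l + (m - ?e)) (of_nat (Poly_Mapping.lookup m x) * (c::'b))" for m l c
  proof (cases "Poly_Mapping.lookup m x = 0")
    case False
    then have "m + l - ?e = l + (m - ?e)"
      by (intro poly_mapping_eqI) (auto simp: lookup_add lookup_minus lookup_single when_def)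
    then show ?thesis by simp
  qed simp
  have s: "mpderiv x (Poly_Mapping.single m a * Poly_Mapping.single l b)
     = Poly_Mapping.single m a * mpderiv x (Poly_Mapping.single l b)
       + Poly_Mapping.single l b * mpderiv x (Poly_Mapping.single m (a::'b))" for m l a b
  proof -
    have "mpderiv x (Poly_Mapping.single m a * Poly_Mapping.single l b)
       = Poly_Mapping.single (l + m - ?e) (of_nat (Poly_Mapping.lookup l x) * (a * b))
       + Poly_Mapping.single (m + l - ?e) (of_nat (Poly_Mapping.lookup m x) * (a * b))"
      by (simp only: mult_single mpderiv_single lookup_add of_nat_add distrib_right single_add
          add.commute[of l m] add.commute[of "Poly_Mapping.single _ (of_nat (Poly_Mapping.lookup m x) * (a * b))"])
    then show ?thesis
      unfolding shift mpderiv_single mult_single by (simp only: ac_simps)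
  qed
  define P where "P m = Poly_Mapping.single m (Poly_Mapping.lookup p m)" for m
  define Q where "Q m = Poly_Mapping.single m (Poly_Mapping.lookup q m)" for m
  have p: "p = sum P (Poly_Mapping.keys p)" and q: "q = sum Q (Poly_Mapping.keys q)"
    unfolding P_def Q_def by (rule mpoly_expand; simp)+
  have "mpderiv x (p * q) = mpderiv x (sum P (Poly_Mapping.keys p) * sum Q (Poly_Mapping.keys q))"
    using p q by simp
  also have "\<dots> = (\<Sum>m\<in>Poly_Mapping.keys p. \<Sum>l\<in>Poly_Mapping.keys q.
      P m * mpderiv x (Q l) + Q l * mpderiv x (P m))"
    by (simp add: sum_product mpderiv_sum P_def Q_def s)
  also have "\<dots> = sum P (Poly_Mapping.keys p) * mpderiv x (sum Q (Poly_Mapping.keys q))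
      + sum Q (Poly_Mapping.keys q) * mpderiv x (sum P (Poly_Mapping.keys p))"
    by (simp add: sum.distrib mpderiv_sum sum_product)
       (simp add: sum.swap[of _ "Poly_Mapping.keys q"])
  finally show ?thesis using p q by simp
qed

text \<open>Monomials without \<open>x\<close> get coefficient \<open>0\<close>, so no truncation
  occurs in a surviving one. The converse may fail in positive characteristic, where an exponent can
  be zero as a coefficient.\<close>

lemma keys_mpderiv:
  assumes "m \<in> Poly_Mapping.keys (mpderiv x p)"
  obtains m' where "m' \<in> Poly_Mapping.keys p" "m' = m + Poly_Mapping.single x 1"
proof -
  have "m \<in> (\<Union>m\<in>Poly_Mapping.keys p. Poly_Mapping.keys (Poly_Mapping.single (m - Poly_Mapping.single x 1)
       (of_nat (Poly_Mapping.lookup m x) * Poly_Mapping.lookup p m)))"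
    using assms keys_sum_subset unfolding mpderiv_def by (rule set_rev_mp)
  then obtain m' where m': "m' \<in> Poly_Mapping.keys p" "m = m' - Poly_Mapping.single x 1"
      "of_nat (Poly_Mapping.lookup m' x) * Poly_Mapping.lookup p m' \<noteq> 0"
    by (auto split: if_splits)
  then have "Poly_Mapping.lookup m' x \<noteq> 0" by (intro notI) simp
  then have "m' = m + Poly_Mapping.single x 1"
    unfolding m'(2)
    by (intro poly_mapping_eqI) (auto simp: lookup_add lookup_minus lookup_single when_def)
  then show ?thesis using m'(1) that by blast
qed

subsection \<open>The lower bound for the rank\<close>

interpretation mpoly_vs: vector_space
  "\<lambda>(c::'a::field) (p::('v, 'a) mpoly). Poly_Mapping.single 0 c * p"
  by unfold_locales
     (simp_all add: algebra_simps single_add mult_single mult.assoc[symmetric])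

text \<open>A box of exponents rather than all monomials of bounded degree, because its cardinality
  is a pure power; its members still have degree at most \<open>n * d * k\<close>.\<close>

definition monom_box :: "nat \<Rightarrow> nat \<Rightarrow> nat \<Rightarrow> (nat \<times> nat \<Rightarrow>\<^sub>0 nat) set" where
  "monom_box d n k = {u. Poly_Mapping.keys u \<subseteq> coords d n \<and> (\<forall>x. Poly_Mapping.lookup u x \<le> k)}"

text \<open>Monomials in the complement of the ideal of the partial derivatives of \<open>Pn\<close>.\<close>

definition residual_monoms :: "nat \<Rightarrow> nat \<Rightarrow> (nat \<times> nat \<Rightarrow>\<^sub>0 nat) set" where
  "residual_monoms d n = {u. Poly_Mapping.keys u \<subseteq> coords d n \<and>
     (\<forall>i<n. \<exists>j<d. \<exists>j'<d. j \<noteq> j' \<and> Poly_Mapping.lookup u (i, j) = 0 \<and> Poly_Mapping.lookup u (i, j') = 0)}"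

text \<open>Each factor \<open>f i\<close> counts as \<open>1\<close> towards the bound
  \<open>T\<close>, whatever its own degree: rewriting a monomial introduces one such factor at a
  time, while the degree of the remaining cofactor drops by at least one.\<close>

definition power_products ::
  "'i set \<Rightarrow> ('i \<Rightarrow> ('v, 'a::comm_ring_1) mpoly) \<Rightarrow> ('v \<Rightarrow>\<^sub>0 nat) set \<Rightarrow> nat \<Rightarrow> ('v, 'a) mpoly set" where
  "power_products F f B T = {(\<Prod>i\<in>F. f i ^ \<alpha> i) * Poly_Mapping.single b 1 | \<alpha> b.
     b \<in> B \<and> (\<Sum>i\<in>F. \<alpha> i) + monom_deg b \<le> T}"

lemma power_products_mono: "T \<le> T' \<Longrightarrow> power_products F f B T \<subseteq> power_products F f B T'"
  unfolding power_products_def by (blast intro: order_trans)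

lemma span_power_products_mult:
  assumes "finite F" "i \<in> F" "p \<in> mpoly_vs.span (power_products F f B T)"
  shows "f i * p \<in> mpoly_vs.span (power_products F f B (Suc T))"
  using assms(3)
proof (rule mpoly_vs.span_induct)
  show "mpoly_vs.subspace {p. f i * p \<in> mpoly_vs.span (power_products F f B (Suc T))}"
    by (auto simp: mpoly_vs.subspace_def distrib_left mult.left_commute[of "f i"]
        mpoly_vs.span_zero mpoly_vs.span_add mpoly_vs.span_scale)
next
  fix p assume "p \<in> power_products F f B T"
  then obtain \<alpha> b where p: "p = (\<Prod>i\<in>F. f i ^ \<alpha> i) * Poly_Mapping.single b 1"
    and b: "b \<in> B" "(\<Sum>i\<in>F. \<alpha> i) + monom_deg b \<le> T"
    by (auto simp: power_products_def)
  define \<beta> where "\<beta> = \<alpha>(i := Suc (\<alpha> i))"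
  have "(\<Prod>k\<in>F. f k ^ \<beta> k) = f i * (\<Prod>k\<in>F. f k ^ \<alpha> k)"
    using assms(1,2) by (simp add: \<beta>_def prod.remove[of F i] mult.assoc)
  then have "f i * p = (\<Prod>k\<in>F. f k ^ \<beta> k) * Poly_Mapping.single b 1"
    by (simp add: p mult.assoc)
  moreover have "(\<Sum>k\<in>F. \<beta> k) = Suc (\<Sum>k\<in>F. \<alpha> k)"
    using assms(1,2) by (simp add: \<beta>_def sum.remove[of F i])
  ultimately have "f i * p \<in> power_products F f B (Suc T)"
    using b unfolding power_products_def by force
  then show "f i * p \<in> mpoly_vs.span (power_products F f B (Suc T))"
    by (rule mpoly_vs.span_base)
qed

section \<open>Counting monomials and power products\<close>

lemma lookup_eq_0I: "Poly_Mapping.keys u \<subseteq> I \<Longrightarrow> x \<notin> I \<Longrightarrow> Poly_Mapping.lookup u x = 0"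
  by (auto simp: in_keys_iff)

lemma finite_monoms_deg_le:
  fixes I :: "'v set"
  assumes "finite I"
  shows "finite {u :: 'v \<Rightarrow>\<^sub>0 nat. Poly_Mapping.keys u \<subseteq> I \<and> monom_deg u \<le> T}"
proof (rule inj_on_finite)
  show "inj_on (\<lambda>u. restrict (Poly_Mapping.lookup u) I) {u. Poly_Mapping.keys u \<subseteq> I \<and> monom_deg u \<le> T}"
  proof (rule inj_onI, rule poly_mapping_eqI)
    fix u u' :: "'v \<Rightarrow>\<^sub>0 nat" and x
    assume "u \<in> {u. Poly_Mapping.keys u \<subseteq> I \<and> monom_deg u \<le> T}"
      "u' \<in> {u. Poly_Mapping.keys u \<subseteq> I \<and> monom_deg u \<le> T}"
      "restrict (Poly_Mapping.lookup u) I = restrict (Poly_Mapping.lookup u') I"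
    then show "Poly_Mapping.lookup u x = Poly_Mapping.lookup u' x"
      by (cases "x \<in> I") (auto simp: lookup_eq_0I dest: fun_cong[where x = x])
  qed
  show "(\<lambda>u. restrict (Poly_Mapping.lookup u) I) ` {u. Poly_Mapping.keys u \<subseteq> I \<and> monom_deg u \<le> T}
      \<subseteq> PiE I (\<lambda>_. {..T})"
  proof safe
    fix u :: "'v \<Rightarrow>\<^sub>0 nat" and x assume u: "Poly_Mapping.keys u \<subseteq> I" "monom_deg u \<le> T" "x \<in> I"
    have "Poly_Mapping.lookup u x \<le> (\<Sum>y\<in>I. Poly_Mapping.lookup u y)"
      using assms u(3) by (intro member_le_sum) auto
    then show "restrict (Poly_Mapping.lookup u) I x \<le> T"
      using u monom_deg_superset[OF assms u(1)] by simp
  qed (auto simp: restrict_def)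
  show "finite (PiE I (\<lambda>_. {..T}))" using assms by (intro finite_PiE) auto
qed

lemma card_power_products:
  assumes "finite F" "finite {b \<in> B. monom_deg b \<le> T}"
  shows "finite (power_products F f B T)"
    and "card (power_products F f B T) \<le> (T + 1) ^ card F * card {b \<in> B. monom_deg b \<le> T}"
proof -
  let ?D = "PiE F (\<lambda>_. {..T}) \<times> {b \<in> B. monom_deg b \<le> T}"
  let ?g = "\<lambda>(\<alpha>, b). (\<Prod>i\<in>F. f i ^ \<alpha> i) * Poly_Mapping.single b 1"
  have sub: "power_products F f B T \<subseteq> ?g ` ?D"
  proof
    fix p assume "p \<in> power_products F f B T"
    then obtain \<alpha> b where p: "p = (\<Prod>i\<in>F. f i ^ \<alpha> i) * Poly_Mapping.single b 1"
      and b: "b \<in> B" "(\<Sum>i\<in>F. \<alpha> i) + monom_deg b \<le> T"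
      by (auto simp: power_products_def)
    have "\<alpha> i \<le> T" if "i \<in> F" for i
    proof -
      have "\<alpha> i \<le> (\<Sum>i\<in>F. \<alpha> i)" using assms(1) that by (intro member_le_sum) auto
      then show ?thesis using b by simp
    qed
    then have "(restrict \<alpha> F, b) \<in> ?D" using b by auto
    moreover have "p = ?g (restrict \<alpha> F, b)" by (simp add: p)
    ultimately show "p \<in> ?g ` ?D" by blast
  qed
  have fin: "finite ?D" using assms by (auto intro!: finite_PiE)
  then show "finite (power_products F f B T)" using sub finite_subset by blast
  have "card (power_products F f B T) \<le> card ?D"
    using fin sub by (rule surj_card_le)
  also have "\<dots> = (T + 1) ^ card F * card {b \<in> B. monom_deg b \<le> T}"
    using assms(1) by (simp add: card_cartesian_product card_PiE)
  finally show "card (power_products F f B T) \<le> (T + 1) ^ card F * card {b \<in> B. monom_deg b \<le> T}" .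
qed

text \<open>Union bound over the at most \<open>d^2\<close> ordered pairs of vanishing columns:
  fixing two entries saves a factor \<open>(T + 1)^2\<close>. That factor stands on the left so that
  no exponent \<open>d - 2\<close> appears; for \<open>d < 2\<close> no row qualifies.\<close>

lemma card_rows_le:
  "card {e \<in> PiE {..<d} (\<lambda>_. {..T}). \<exists>j<d. \<exists>j'<d. j \<noteq> j' \<and> e j = 0 \<and> e j' = 0} * (T + 1)^2
    \<le> d^2 * (T + 1) ^ d"
proof -
  let ?J = "{(j, j'). j < d \<and> j' < d \<and> j \<noteq> j'}"
  let ?E = "\<lambda>(j, j'). PiE {..<d} (\<lambda>k. if k = j \<or> k = j' then {0} else {..T})"
  let ?R = "{e \<in> PiE {..<d} (\<lambda>_. {..T}). \<exists>j<d. \<exists>j'<d. j \<noteq> j' \<and> e j = 0 \<and> e j' = 0}"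
  have finJ: "finite ?J" by (rule finite_subset[of _ "{..<d} \<times> {..<d}"]) auto
  have "card ?J \<le> card ({..<d} \<times> {..<d})" by (rule card_mono) auto
  then have cJ: "card ?J \<le> d^2" by (simp add: card_cartesian_product power2_eq_square)
  have cE: "card (?E p) * (T + 1)^2 = (T + 1) ^ d" if "p \<in> ?J" for p
  proof -
    obtain j j' where p: "p = (j, j')" "j < d" "j' < d" "j \<noteq> j'" using \<open>p \<in> ?J\<close> by auto
    have "card (?E p) = (\<Prod>k<d. card (if k = j \<or> k = j' then {0} else {..T}))"
      by (simp add: p(1) card_PiE)
    also have "\<dots> = (\<Prod>k\<in>{..<d} - {j, j'}. T + 1)"
      by (rule prod.mono_neutral_cong_right) auto
    also have "\<dots> = (T + 1) ^ (d - 2)"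
      using p by (simp add: card_Diff_subset numeral_2_eq_2)
    finally have "card (?E p) * (T + 1)^2 = (T + 1) ^ (d - 2 + 2)" by (simp only: power_add)
    also have "d - 2 + 2 = d" using p by simp
    finally show ?thesis .
  qed
  have "?R \<subseteq> (\<Union>p\<in>?J. ?E p)"
  proof
    fix e assume "e \<in> ?R"
    then obtain j j' where e: "e \<in> PiE {..<d} (\<lambda>_. {..T})" "j < d" "j' < d" "j \<noteq> j'" "e j = 0" "e j' = 0"
      by auto
    then have "e \<in> ?E (j, j')" by (auto simp: PiE_iff)
    then show "e \<in> (\<Union>p\<in>?J. ?E p)" using e by blast
  qed
  then have "card ?R \<le> card (\<Union>p\<in>?J. ?E p)"
    by (rule card_mono[rotated]) (use finJ in \<open>auto intro!: finite_PiE\<close>)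
  also have "\<dots> \<le> (\<Sum>p\<in>?J. card (?E p))" by (rule card_UN_le[OF finJ])
  finally have "card ?R * (T + 1)^2 \<le> (\<Sum>p\<in>?J. card (?E p)) * (T + 1)^2" by simp
  also have "\<dots> = (\<Sum>p\<in>?J. (T + 1) ^ d)"
    unfolding sum_distrib_right by (intro sum.cong refl cE)
  also have "\<dots> \<le> d^2 * (T + 1) ^ d" using cJ by simp
  finally show ?thesis .
qed

text \<open>The rows can be bounded independently, and each of the \<open>n\<close> rows loses two
  degrees of freedom; this is where the codimension \<open>2 * n\<close> enters the count.\<close>

lemma card_residual_monoms:
  "card {u \<in> residual_monoms d n. monom_deg u \<le> T} * (T + 1) ^ (2 * n) \<le> d ^ (2 * n) * (T + 1) ^ (d * n)"
proof -
  let ?R = "{e \<in> PiE {..<d} (\<lambda>_. {..T}). \<exists>j<d. \<exists>j'<d. j \<noteq> j' \<and> e j = 0 \<and> e j' = 0}"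
  let ?M = "{u \<in> residual_monoms d n. monom_deg u \<le> T}"
  let ?r = "\<lambda>u. \<lambda>i\<in>{..<n}. \<lambda>j\<in>{..<d}. Poly_Mapping.lookup u (i, j)"
  have finI: "finite (coords d n)" by (simp add: coords_def)
  have "inj_on ?r ?M"
  proof (rule inj_onI, rule poly_mapping_eqI)
    fix u u' :: "nat \<times> nat \<Rightarrow>\<^sub>0 nat" and x
    assume uu: "u \<in> ?M" "u' \<in> ?M" "?r u = ?r u'"
    show "Poly_Mapping.lookup u x = Poly_Mapping.lookup u' x"
    proof (cases "x \<in> coords d n")
      case True
      then obtain i j where "x = (i, j)" "i < n" "j < d" by (auto simp: coords_def)
      then show ?thesis using fun_cong[OF fun_cong[OF uu(3), of i], of j] by simp
    next
      case False
      then show ?thesis using uu by (auto simp: residual_monoms_def lookup_eq_0I)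
    qed
  qed
  moreover have "?r ` ?M \<subseteq> PiE {..<n} (\<lambda>_. ?R)"
  proof
    fix e assume "e \<in> ?r ` ?M"
    then obtain u where u: "u \<in> ?M" and e: "e = ?r u" by auto
    have le: "Poly_Mapping.lookup u x \<le> T" if "x \<in> coords d n" for x
    proof -
      have "Poly_Mapping.lookup u x \<le> (\<Sum>y\<in>coords d n. Poly_Mapping.lookup u y)"
        using finI that by (intro member_le_sum) auto
      also have "\<dots> = monom_deg u"
        using monom_deg_superset[OF finI, of u] u by (simp add: residual_monoms_def)
      finally show ?thesis using u by simp
    qed
    show "e \<in> PiE {..<n} (\<lambda>_. ?R)"
    proof (rule PiE_I)
      fix i assume i: "i \<in> {..<n}"
      then obtain j j' where "j < d" "j' < d" "j \<noteq> j'"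
        "Poly_Mapping.lookup u (i, j) = 0" "Poly_Mapping.lookup u (i, j') = 0"
        using u unfolding residual_monoms_def by blast
      then have "\<exists>j<d. \<exists>j'<d. j \<noteq> j' \<and> e i j = 0 \<and> e i j' = 0"
        using i by (auto simp: e)
      moreover have "e i \<in> PiE {..<d} (\<lambda>_. {..T})"
        using i le by (auto simp: e coords_def)
      ultimately show "e i \<in> ?R" by simp
    qed (simp add: e)
  qed
  moreover have "finite (PiE {..<n} (\<lambda>_. ?R))"
    by (intro finite_PiE finite_Collect_conjI disjI1) (auto intro: finite_PiE)
  ultimately have "card ?M \<le> card (PiE {..<n} (\<lambda>_. ?R))"
    by (meson card_inj_on_le)
  also have "\<dots> = card ?R ^ n" by (simp add: card_PiE)
  finally have "card ?M * (T + 1) ^ (2 * n) \<le> card ?R ^ n * ((T + 1)^2) ^ n"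
    by (simp add: power_mult)
  also have "\<dots> = (card ?R * (T + 1)^2) ^ n" by (simp add: power_mult_distrib)
  also have "\<dots> \<le> (d^2 * (T + 1) ^ d) ^ n"
    by (intro power_mono card_rows_le) simp
  also have "\<dots> = d ^ (2 * n) * (T + 1) ^ (d * n)"
    by (simp add: power_mult_distrib power_mult)
  finally show ?thesis .
qed

text \<open>A monomial outside the residual set is divisible by a partial derivative of
  \<open>Pn\<close>, which \<open>gen\<close> rewrites in terms of the \<open>f \<phi>\<close> with
  cofactors of degree smaller than that of the derivative. The monomials of the new cofactors
  therefore have degree below that of \<open>u\<close>, and induction applies.\<close>

lemma monoms_in_span:
  fixes f :: "'i \<Rightarrow> (nat \<times> nat, 'a::field) mpoly"
  assumes F: "finite F" and d: "d \<ge> 1"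
    and gen: "\<And>i j. i < n \<Longrightarrow> j < d \<Longrightarrow>
       \<exists>g. Poly_Mapping.single (\<Sum>j'\<in>{..<d} - {j}. Poly_Mapping.single (i, j') 1) 1 = (\<Sum>\<phi>\<in>F. f \<phi> * g \<phi>) \<and>
           (\<forall>\<phi>\<in>F. \<forall>m\<in>Poly_Mapping.keys (g \<phi>). Poly_Mapping.keys m \<subseteq> coords d n \<and> monom_deg m < d - 1)"
    and u: "Poly_Mapping.keys u \<subseteq> coords d n"
  shows "Poly_Mapping.single u 1 \<in> mpoly_vs.span (power_products F f (residual_monoms d n) (monom_deg u))"
  using u
proof (induction "monom_deg u" arbitrary: u rule: less_induct)
  case less
  let ?G = "power_products F f (residual_monoms d n)"
  show ?case
  proof (cases "u \<in> residual_monoms d n")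
    case True
    have "Poly_Mapping.single u 1 \<in> ?G (monom_deg u)"
      unfolding power_products_def using True by (intro CollectI exI[of _ "\<lambda>_. 0"] exI[of _ u]) auto
    then show ?thesis by (rule mpoly_vs.span_base)
  next
    case False
    then obtain i where i: "i < n"
      and "\<not> (\<exists>j<d. \<exists>j'<d. j \<noteq> j' \<and> Poly_Mapping.lookup u (i, j) = 0 \<and> Poly_Mapping.lookup u (i, j') = 0)"
      using less.prems unfolding residual_monoms_def by blast
    \<comment> \<open>Row \<open>i\<close> has at most one zero entry; \<open>j\<close> is its
      column, or any column if there is none, and a column exists because
      \<open>d \<ge> 1\<close>.\<close>
    then obtain j where j: "j < d" and nz: "\<And>j'. j' < d \<Longrightarrow> j' \<noteq> j \<Longrightarrow> Poly_Mapping.lookup u (i, j') \<noteq> 0"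
      by (metis d less_eq_Suc_le One_nat_def)
    \<comment> \<open>The exponent vector of the derivative of \<open>Pn\<close> with respect to
      \<open>(i, j)\<close>; by \<open>nz\<close> it divides \<open>u\<close>.\<close>
    define D where "D = (\<Sum>j'\<in>{..<d} - {j}. Poly_Mapping.single (i, j') (1::nat))"
    have lD: "Poly_Mapping.lookup D x = (if fst x = i \<and> snd x < d \<and> snd x \<noteq> j then 1 else 0)" for x
    proof -
      have "Poly_Mapping.lookup D x = (\<Sum>j'\<in>{..<d} - {j}. if j' = snd x then (if fst x = i then 1 else 0) else 0)"
        unfolding D_def lookup_sum by (cases x) (auto intro!: sum.cong simp: lookup_single when_def)
      then show ?thesis by (simp add: sum.delta)
    qed
    have uD: "u = (u - D) + D"
    proof (rule poly_mapping_eqI)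
      fix x
      show "Poly_Mapping.lookup u x = Poly_Mapping.lookup ((u - D) + D) x"
        using nz[of "snd x"] by (cases x) (auto simp: lookup_add lookup_minus lD)
    qed
    have degD: "monom_deg D = d - 1" using j by (simp add: D_def monom_deg_sum)
    have degu: "monom_deg u = monom_deg (u - D) + (d - 1)"
      using uD degD by (metis monom_deg_add)
    have keys': "Poly_Mapping.keys (u - D) \<subseteq> coords d n"
      using less.prems by (auto simp: in_keys_iff lookup_minus subset_iff)
    obtain g where g: "Poly_Mapping.single D 1 = (\<Sum>\<phi>\<in>F. f \<phi> * g \<phi>)"
      and gk: "\<And>\<phi> m. \<phi> \<in> F \<Longrightarrow> m \<in> Poly_Mapping.keys (g \<phi>) \<Longrightarrow>
          Poly_Mapping.keys m \<subseteq> coords d n \<and> monom_deg m < d - 1"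
      using gen[OF i j] unfolding D_def by blast
    have "Poly_Mapping.single u 1 = Poly_Mapping.single (u - D) 1 * Poly_Mapping.single D (1::'a)"
      using uD by (simp add: mult_single)
    also have "\<dots> = (\<Sum>\<phi>\<in>F. f \<phi> * (Poly_Mapping.single (u - D) 1 * g \<phi>))"
      unfolding g by (simp add: sum_distrib_left mult.left_commute)
    also have "\<dots> \<in> mpoly_vs.span (?G (monom_deg u))"
    proof (rule mpoly_vs.span_sum)
      fix \<phi> assume \<phi>: "\<phi> \<in> F"
      let ?q = "Poly_Mapping.single (u - D) 1 * g \<phi>"
      have kq: "Poly_Mapping.keys k \<subseteq> coords d n \<and> monom_deg k < monom_deg u"
        if "k \<in> Poly_Mapping.keys ?q" for k
      proof -
        have "k \<in> {a + b |a b. a \<in> Poly_Mapping.keys (Poly_Mapping.single (u - D) (1::'a)) \<and> b \<in> Poly_Mapping.keys (g \<phi>)}"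
          using that keys_mult by (rule set_rev_mp)
        then obtain b where b: "b \<in> Poly_Mapping.keys (g \<phi>)" "k = (u - D) + b" by auto
        then show ?thesis
          using gk[OF \<phi> b(1)] keys' keys_add[of "u - D" b] degu by (auto simp: monom_deg_add)
      qed
      show "f \<phi> * ?q \<in> mpoly_vs.span (?G (monom_deg u))"
      proof (cases "monom_deg u")
        case 0
        then have "?q = 0" using kq by (metis keys_eq_empty less_nat_zero_code equals0I)
        then show ?thesis by (simp add: mpoly_vs.span_zero)
      next
        case (Suc T)
        have "(\<Sum>m\<in>Poly_Mapping.keys ?q. Poly_Mapping.single m (Poly_Mapping.lookup ?q m))
            \<in> mpoly_vs.span (?G T)"
          proof (rule mpoly_vs.span_sum)
            fix m assume m: "m \<in> Poly_Mapping.keys ?q"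
            then have "Poly_Mapping.single m 1 \<in> mpoly_vs.span (?G (monom_deg m))"
              using kq by (intro less.hyps) auto
            also have "\<dots> \<subseteq> mpoly_vs.span (?G T)"
              using kq[OF m] Suc by (intro mpoly_vs.span_mono power_products_mono) auto
            finally have "Poly_Mapping.single 0 (Poly_Mapping.lookup ?q m) * Poly_Mapping.single m 1
                \<in> mpoly_vs.span (?G T)" by (rule mpoly_vs.span_scale)
            then show "Poly_Mapping.single m (Poly_Mapping.lookup ?q m) \<in> mpoly_vs.span (?G T)"
              by (simp add: mult_single)
          qed
        then have "?q \<in> mpoly_vs.span (?G T)"
          using mpoly_expand[of "Poly_Mapping.keys ?q" ?q] by simp
        then show ?thesis unfolding Suc by (rule span_power_products_mult[OF F \<phi>])
      qed
    qed
    finally show ?thesis .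
  qed
qed

lemma independent_monoms:
  "mpoly_vs.independent ((\<lambda>u :: 'v \<Rightarrow>\<^sub>0 nat. Poly_Mapping.single u (1::'a::field)) ` M)"
  unfolding mpoly_vs.independent_explicit_module
proof (intro allI impI)
  fix t c and v :: "('v, 'a) mpoly"
  assume t: "finite t" "t \<subseteq> (\<lambda>u. Poly_Mapping.single u 1) ` M"
    and s: "(\<Sum>v\<in>t. Poly_Mapping.single 0 (c v) * v) = 0" and v: "v \<in> t"
  then obtain u where u: "v = Poly_Mapping.single u 1" by auto
  have "0 = Poly_Mapping.lookup (\<Sum>v\<in>t. Poly_Mapping.single 0 (c v) * v) u"
    using s by simp
  also have "\<dots> = (\<Sum>w\<in>t. if w = v then c v else 0)"
    unfolding lookup_sum
  proof (intro sum.cong refl)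
    fix w assume "w \<in> t"
    then obtain u' where "w = Poly_Mapping.single u' 1" using t by auto
    then show "Poly_Mapping.lookup (Poly_Mapping.single 0 (c w) * w) u = (if w = v then c v else 0)"
      unfolding u by (auto simp: mult_single lookup_single when_def dest: arg_cong[of _ _ "\<lambda>p. Poly_Mapping.lookup p u"])
  qed
  also have "\<dots> = c v" using t(1) v by simp
  finally show "c v = 0" by simp
qed

lemma card_monom_box: "card (monom_box d n k) = (k + 1) ^ (n * d)"
proof -
  let ?I = "coords d n"
  have fin: "finite ?I" by (simp add: coords_def)
  let ?h = "\<lambda>e. Abs_poly_mapping (\<lambda>x. if x \<in> ?I then e x else 0)"
  have l: "Poly_Mapping.lookup (?h e) = (\<lambda>x. if x \<in> ?I then e x else (0::nat))" for e
    by (rule lookup_Abs_poly_mapping) (rule finite_subset[OF _ fin], auto)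
  have "bij_betw ?h (PiE ?I (\<lambda>_. {..k})) (monom_box d n k)"
  proof (rule bij_betwI[where g = "\<lambda>u. restrict (Poly_Mapping.lookup u) ?I"])
    show "?h \<in> PiE ?I (\<lambda>_. {..k}) \<rightarrow> monom_box d n k"
      by (auto simp: monom_box_def l in_keys_iff PiE_iff split: if_splits)
    show "(\<lambda>u. restrict (Poly_Mapping.lookup u) ?I) \<in> monom_box d n k \<rightarrow> PiE ?I (\<lambda>_. {..k})"
      by (auto simp: monom_box_def)
    show "restrict (Poly_Mapping.lookup (?h e)) ?I = e" if "e \<in> PiE ?I (\<lambda>_. {..k})" for e
      using that by (auto simp: l fun_eq_iff PiE_iff extensional_def)
    show "?h (restrict (Poly_Mapping.lookup u) ?I) = u" if "u \<in> monom_box d n k" for u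
      using that by (intro poly_mapping_eqI) (auto simp: l monom_box_def in_keys_iff subset_iff)
  qed
  then have "card (monom_box d n k) = card (PiE ?I (\<lambda>_. {..k}))" by (simp add: bij_betw_same_card)
  also have "\<dots> = (k + 1) ^ (n * d)"
    using fin by (simp add: card_PiE) (simp add: coords_def card_cartesian_product)
  finally show ?thesis .
qed

text \<open>A weak form of Krull's height theorem: the partial derivatives of \<open>Pn\<close> cut out a locus of
  codimension \<open>2 n\<close>, so they do not lie in an ideal with fewer than \<open>2 n\<close> generators.  The codimensions
  are compared through the growth of the number of monomials of bounded degree.\<close>

lemma card_generators_ge:
  fixes f :: "'i \<Rightarrow> (nat \<times> nat, 'a::field) mpoly"
  assumes F: "finite F" and d: "d \<ge> 1" and n: "n \<ge> 1"
    and gen: "\<And>i j. i < n \<Longrightarrow> j < d \<Longrightarrow>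
       \<exists>g. Poly_Mapping.single (\<Sum>j'\<in>{..<d} - {j}. Poly_Mapping.single (i, j') 1) 1 = (\<Sum>\<phi>\<in>F. f \<phi> * g \<phi>) \<and>
           (\<forall>\<phi>\<in>F. \<forall>m\<in>Poly_Mapping.keys (g \<phi>). Poly_Mapping.keys m \<subseteq> coords d n \<and> monom_deg m < d - 1)"
  shows "2 * n \<le> card F"
proof (rule ccontr)
  assume less: "\<not> 2 * n \<le> card F"
  \<comment> \<open>\<open>T\<close> is the largest degree in the box with exponents up to
    \<open>C\<close>, and \<open>C\<close> absorbs all factors that do not involve \<open>T\<close>.
    If \<open>card F < 2 * n\<close>, comparing powers of \<open>T + 1\<close> forces
    \<open>T + 1 \<le> C\<close>, against \<open>C \<le> T\<close>.\<close>
  define C where "C = d ^ (2 * n) * (n * d) ^ (n * d)"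
  define T where "T = n * d * C"
  let ?B = "{u \<in> residual_monoms d n. monom_deg u \<le> T}"
  let ?S = "(\<lambda>u. Poly_Mapping.single u (1::'a)) ` monom_box d n C"
  have fin: "finite (coords d n)" by (simp add: coords_def)
  have finB: "finite ?B"
    by (rule finite_subset[OF _ finite_monoms_deg_le[OF fin, of T]]) (auto simp: residual_monoms_def)
  have "?S \<subseteq> mpoly_vs.span (power_products F f (residual_monoms d n) T)"
  proof
    fix p assume "p \<in> ?S"
    then obtain u where u: "u \<in> monom_box d n C" and p: "p = Poly_Mapping.single u 1" by auto
    have "monom_deg u = (\<Sum>x\<in>coords d n. Poly_Mapping.lookup u x)"
      using u by (intro monom_deg_superset fin) (auto simp: monom_box_def)
    also have "\<dots> \<le> (\<Sum>x\<in>coords d n. C)"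
      using u by (intro sum_mono) (auto simp: monom_box_def)
    also have "\<dots> = T" by (simp add: T_def coords_def card_cartesian_product)
    finally have uT: "monom_deg u \<le> T" .
    have "p \<in> mpoly_vs.span (power_products F f (residual_monoms d n) (monom_deg u))"
      unfolding p using u by (intro monoms_in_span F d gen) (auto simp: monom_box_def)
    also have "\<dots> \<subseteq> mpoly_vs.span (power_products F f (residual_monoms d n) T)"
      using uT by (intro mpoly_vs.span_mono power_products_mono)
    finally show "p \<in> mpoly_vs.span (power_products F f (residual_monoms d n) T)" .
  qed
  then have "card ?S \<le> card (power_products F f (residual_monoms d n) T)"
    using mpoly_vs.independent_span_bound[OF card_power_products(1)[OF F finB] independent_monoms] by blast
  also have "\<dots> \<le> (T + 1) ^ card F * card ?B" by (rule card_power_products(2)[OF F finB])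
  also have "card ?S = (C + 1) ^ (n * d)"
  proof -
    have "card ?S = card (monom_box d n C)"
      by (rule card_image) (auto intro!: inj_onI dest: arg_cong[of _ _ Poly_Mapping.keys])
    then show ?thesis by (simp add: card_monom_box)
  qed
  finally have 1: "(C + 1) ^ (n * d) \<le> (T + 1) ^ card F * card ?B" .
  have nd: "n * d \<ge> 1" using n d by simp
  then have "T + 1 \<le> n * d * (C + 1)" unfolding T_def by (simp add: distrib_left)
  then have "(T + 1) ^ (n * d) \<le> (n * d * (C + 1)) ^ (n * d)" by (rule power_mono) simp
  then have 2: "(T + 1) ^ (n * d) \<le> (n * d) ^ (n * d) * (C + 1) ^ (n * d)"
    by (simp only: power_mult_distrib)
  have "(C + 1) ^ (n * d) * (T + 1) ^ (2 * n) \<le> (T + 1) ^ card F * (card ?B * (T + 1) ^ (2 * n))"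
    using mult_le_mono1[OF 1, of "(T + 1) ^ (2 * n)"] by (simp only: mult.assoc)
  also have "\<dots> \<le> (T + 1) ^ card F * (d ^ (2 * n) * (T + 1) ^ (n * d))"
    using card_residual_monoms[of d n T] by (intro mult_le_mono2) (simp only: mult.commute[of n d])
  also have "\<dots> \<le> (T + 1) ^ card F * (d ^ (2 * n) * ((n * d) ^ (n * d) * (C + 1) ^ (n * d)))"
    by (intro mult_le_mono2 2)
  also have "\<dots> = (C + 1) ^ (n * d) * ((T + 1) ^ card F * C)" by (simp add: C_def)
  finally have "(T + 1) ^ (2 * n) \<le> (T + 1) ^ card F * C" by simp
  moreover have "(T + 1) ^ (card F + 1) \<le> (T + 1) ^ (2 * n)"
    using less by (intro power_increasing) auto
  ultimately have "(T + 1) ^ card F * (T + 1) \<le> (T + 1) ^ card F * C"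
    by (metis le_trans power_add power_one_right)
  then have "T + 1 \<le> C" by (subst (asm) mult_le_cancel1) simp
  moreover have "C \<le> T" using nd unfolding T_def by simp
  ultimately show False by simp
qed

text \<open>The \<open>2 * r * (d - 1)\<close> homogeneous components of the factors generate an
  ideal containing all partial derivatives of \<open>Pn\<close>, so there must be at least
  \<open>2 * n\<close> of them. For \<open>d = 1\<close> the bound says that no representation
  exists.\<close>

lemma rank_representation_bound:
  fixes Q R :: "nat \<Rightarrow> (nat \<times> nat, 'a::field) mpoly"
  assumes d: "d \<ge> 1" and n: "n \<ge> 1"
    and Q: "\<And>i. i < r \<Longrightarrow> mvars (Q i) \<subseteq> coords d n \<and> total_degree (Q i) < d"
    and R: "\<And>i. i < r \<Longrightarrow> mvars (R i) \<subseteq> coords d n \<and> total_degree (R i) < d"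
    and P: "Pn d n = (\<Sum>i<r. Q i * R i)"
  shows "n \<le> r * (d - 1)"
proof -
  define F where "F = (UNIV :: bool set) \<times> {..<r} \<times> {1..<d}"
  \<comment> \<open>\<open>True\<close> selects the component of degree \<open>j\<close> of
    \<open>Q i\<close>, \<open>False\<close> the complementary one of \<open>R i\<close>. In
    \<open>g\<close> below the roles are exchanged, since the Leibniz rule pairs a factor with the
    derivative of its partner.\<close>
  define f where "f = (\<lambda>(b, i, j). if b then hpart j (Q i) else hpart (d - j) (R i))"
  have Pn: "Pn d n = (\<Sum>i<r. \<Sum>j\<in>{1..<d}. hpart j (Q i) * hpart (d - j) (R i))"
  proof -
    have "Pn d n = hpart d (Pn d n :: (nat \<times> nat, 'a) mpoly)"
      using hpart_homogeneous[of "Pn d n :: (nat \<times> nat, 'a) mpoly" d d]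
        monom_deg_Pn[where ?'k = 'a] by metis
    also have "\<dots> = (\<Sum>i<r. hpart d (Q i * R i))" unfolding P by (rule hpart_sum)
    also have "\<dots> = (\<Sum>i<r. \<Sum>j\<in>{1..<d}. hpart j (Q i) * hpart (d - j) (R i))"
      using Q R by (intro sum.cong refl hpart_mult) (auto intro: total_degree_less_imp)
    finally show ?thesis .
  qed
  have "2 * n \<le> card F"
  proof (rule card_generators_ge[where f = f and d = d])
    show "finite F" by (simp add: F_def)
    fix i0 j0 assume ij: "i0 < n" "j0 < d"
    define x where "x = (i0, j0)"
    define g where "g = (\<lambda>(b, i, j). if b then mpderiv x (hpart (d - j) (R i)) else mpderiv x (hpart j (Q i)))"
    have "mpderiv x (Pn d n :: (nat \<times> nat, 'a) mpoly) = (\<Sum>i<n. if i = i0 then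
        Poly_Mapping.single (\<Sum>j'\<in>{..<d} - {j0}. Poly_Mapping.single (i, j') 1) 1 else 0)"
      unfolding Pn_conv_single mpderiv_sum
    proof (intro sum.cong refl)
      fix i
      have l: "Poly_Mapping.lookup (\<Sum>j<d. Poly_Mapping.single (i, j) (1::nat)) x = (if i = i0 then 1 else 0)"
        unfolding lookup_sum x_def using ij by (auto simp: lookup_single when_def)
      have "(\<Sum>j<d. Poly_Mapping.single (i0, j) (1::nat)) - Poly_Mapping.single x 1
          = (\<Sum>j'\<in>{..<d} - {j0}. Poly_Mapping.single (i0, j') 1)"
        using ij by (subst sum.remove[of _ j0]) (auto simp: x_def)
      then show "mpderiv x (Poly_Mapping.single (\<Sum>j<d. Poly_Mapping.single (i, j) 1) (1::'a))
        = (if i = i0 then Poly_Mapping.single (\<Sum>j'\<in>{..<d} - {j0}. Poly_Mapping.single (i, j') 1) 1 else 0)"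
        unfolding mpderiv_single l by auto
    qed
    also have "\<dots> = Poly_Mapping.single (\<Sum>j'\<in>{..<d} - {j0}. Poly_Mapping.single (i0, j') 1) 1"
      using ij by simp
    finally have "Poly_Mapping.single (\<Sum>j'\<in>{..<d} - {j0}. Poly_Mapping.single (i0, j') 1) 1
        = mpderiv x (\<Sum>i<r. \<Sum>j\<in>{1..<d}. hpart j (Q i) * hpart (d - j) (R i))"
      using Pn by simp
    also have "\<dots> = (\<Sum>\<phi>\<in>F. f \<phi> * g \<phi>)"
      by (simp add: F_def UNIV_bool sum.cartesian_product' mpderiv_sum mpderiv_mult
          f_def g_def sum.distrib add.commute)
    finally have DF: "Poly_Mapping.single (\<Sum>j'\<in>{..<d} - {j0}. Poly_Mapping.single (i0, j') 1) 1
        = (\<Sum>\<phi>\<in>F. f \<phi> * g \<phi>)" .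
    have dk: "Poly_Mapping.keys m \<subseteq> coords d n \<and> monom_deg m < d - 1"
      if "m \<in> Poly_Mapping.keys (mpderiv x (hpart k p))" "k < d" "mvars p \<subseteq> coords d n" for m k p
    proof -
      obtain m' where m': "m' \<in> Poly_Mapping.keys (hpart k p)" "m' = m + Poly_Mapping.single x 1"
        using \<open>m \<in> _\<close> by (rule keys_mpderiv)
      then have "monom_deg m + 1 = k"
        by (auto simp: keys_hpart monom_deg_add)
      moreover have "Poly_Mapping.keys m \<subseteq> Poly_Mapping.keys m'"
        unfolding m'(2) by (auto simp: in_keys_iff lookup_add)
      moreover have "Poly_Mapping.keys m' \<subseteq> coords d n"
        using m'(1) \<open>mvars p \<subseteq> _\<close> by (auto simp: keys_hpart mvars_subset_iff)
      ultimately show ?thesis using \<open>k < d\<close> by auto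
    qed
    have gk: "\<forall>\<phi>\<in>F. \<forall>m\<in>Poly_Mapping.keys (g \<phi>). Poly_Mapping.keys m \<subseteq> coords d n \<and> monom_deg m < d - 1"
    proof (intro ballI)
      fix \<phi> m assume "\<phi> \<in> F" and m: "m \<in> Poly_Mapping.keys (g \<phi>)"
      then obtain b i j where \<phi>: "\<phi> = (b, i, j)" "i < r" "1 \<le> j" "j < d"
        by (auto simp: F_def)
      show "Poly_Mapping.keys m \<subseteq> coords d n \<and> monom_deg m < d - 1"
        using m dk[of m "d - j" "R i"] dk[of m j "Q i"] Q[OF \<phi>(2)] R[OF \<phi>(2)] \<phi>
        by (cases b) (simp_all add: g_def)
    qed
    show "\<exists>g. Poly_Mapping.single (\<Sum>j'\<in>{..<d} - {j0}. Poly_Mapping.single (i0, j') 1) 1 = (\<Sum>\<phi>\<in>F. f \<phi> * g \<phi>) \<and>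
        (\<forall>\<phi>\<in>F. \<forall>m\<in>Poly_Mapping.keys (g \<phi>). Poly_Mapping.keys m \<subseteq> coords d n \<and> monom_deg m < d - 1)"
      using DF gk by blast
  qed (use d n in auto)
  also have "card F = 2 * (r * (d - 1))" by (simp add: F_def card_cartesian_product)
  finally show ?thesis by simp
qed

text \<open>The infimum is attained unless no representation exists, when it is infinite. The bound
  \<open>n \<le> r * (d - 1)\<close> is weakened to \<open>n \<le> r * d\<close>, whence the
  quotient.\<close>

lemma poly_rank_Pn_ge:
  assumes "d \<ge> 1" "n \<ge> 1"
  shows "ereal (real n / real d) \<le> ereal_of_enat (poly_rank (coords d n) (Pn d n :: (nat \<times> nat, 'k::field) mpoly))"
proof -
  let ?P = "Pn d n :: (nat \<times> nat, 'k) mpoly"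
  let ?S = "{enat r | r. \<exists>Q R :: nat \<Rightarrow> (nat \<times> nat, 'k) mpoly.
     (\<forall>i<r. mvars (Q i) \<subseteq> coords d n \<and> mvars (R i) \<subseteq> coords d n \<and>
            total_degree (Q i) < total_degree ?P \<and> total_degree (R i) < total_degree ?P) \<and>
     ?P = (\<Sum>i<r. Q i * R i)}"
  show ?thesis
  proof (cases "?S = {}")
    case True
    then show ?thesis unfolding poly_rank_def by (simp add: Inf_enat_def)
  next
    case False
    then have "Inf ?S \<in> ?S" by (metis (no_types, lifting) Inf_enat_def LeastI ex_in_conv)
    then obtain r and Q R :: "nat \<Rightarrow> (nat \<times> nat, 'k) mpoly" where r: "Inf ?S = enat r"
      and QR: "\<forall>i<r. mvars (Q i) \<subseteq> coords d n \<and> mvars (R i) \<subseteq> coords d n \<and>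
            total_degree (Q i) < total_degree ?P \<and> total_degree (R i) < total_degree ?P"
        "?P = (\<Sum>i<r. Q i * R i)"
      by blast
    have "n \<le> r * (d - 1)"
      using QR assms total_degree_Pn[of d n, where ?'k = 'k]
      by (intro rank_representation_bound[of d n r Q R]) (auto intro: less_le_trans)
    also have "\<dots> \<le> r * d" by simp
    finally have "real n \<le> real r * real d" by (metis of_nat_le_iff of_nat_mult)
    then have "real n / real d \<le> real r" using assms by (simp add: divide_le_eq)
    then show ?thesis unfolding poly_rank_def r by simp
  qed
qed

subsection \<open>Evaluation of polynomials\<close>

lemma monom_eval_superset:
  fixes v :: "'v \<Rightarrow> 'a::comm_ring_1"
  assumes "finite A" "Poly_Mapping.keys m \<subseteq> A"
  shows "(\<Prod>x\<in>Poly_Mapping.keys m. v x ^ Poly_Mapping.lookup m x) = (\<Prod>x\<in>A. v x ^ Poly_Mapping.lookup m x)"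
  using assms by (intro prod.mono_neutral_left) (auto simp: in_keys_iff)

lemma mpoly_eval_superset:
  fixes v :: "'v \<Rightarrow> 'a::comm_ring_1"
  assumes "finite A" "Poly_Mapping.keys p \<subseteq> A"
  shows "mpoly_eval v p = (\<Sum>m\<in>A. Poly_Mapping.lookup p m *
        (\<Prod>x\<in>Poly_Mapping.keys m. v x ^ Poly_Mapping.lookup m x))"
  unfolding mpoly_eval_def using assms
  by (intro sum.mono_neutral_left) (auto simp: in_keys_iff)

lemma mpoly_eval_add: "mpoly_eval v (p + q) = mpoly_eval v p + mpoly_eval v q"
proof -
  let ?A = "Poly_Mapping.keys p \<union> Poly_Mapping.keys q"
  have "mpoly_eval v (p + q) = (\<Sum>m\<in>?A. Poly_Mapping.lookup (p + q) m *
        (\<Prod>x\<in>Poly_Mapping.keys m. v x ^ Poly_Mapping.lookup m x))"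
    by (intro mpoly_eval_superset) (auto simp: keys_add)
  also have "\<dots> = mpoly_eval v p + mpoly_eval v q"
    by (simp add: mpoly_eval_superset[of ?A] lookup_add distrib_right sum.distrib)
  finally show ?thesis .
qed

lemma mpoly_eval_0 [simp]: "mpoly_eval v 0 = 0"
  by (simp add: mpoly_eval_def)

lemma mpoly_eval_sum: "mpoly_eval v (sum f A) = (\<Sum>x\<in>A. mpoly_eval v (f x))"
  by (induction A rule: infinite_finite_induct) (auto simp: mpoly_eval_add)

lemma mpoly_eval_single:
  "mpoly_eval v (Poly_Mapping.single m c)
     = c * (\<Prod>x\<in>Poly_Mapping.keys m. v x ^ Poly_Mapping.lookup m x)"
  by (cases "c = 0") (auto simp: mpoly_eval_def)

lemma lookup_scale: "Poly_Mapping.lookup (Poly_Mapping.single 0 c * p) m = c * Poly_Mapping.lookup p m"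
  for p :: "('v, 'a::comm_ring_1) mpoly"
  unfolding mult_map_scale_conv_mult[symmetric] by (auto simp: map.rep_eq when_def)

lemma keys_scale: "Poly_Mapping.keys (Poly_Mapping.single 0 c * p) \<subseteq> Poly_Mapping.keys p"
  for p :: "('v, 'a::comm_ring_1) mpoly"
  by (auto simp: in_keys_iff lookup_scale)

lemma mpoly_eval_scale: "mpoly_eval v (Poly_Mapping.single 0 c * p) = c * mpoly_eval v p"
proof -
  have "mpoly_eval v (Poly_Mapping.single 0 c * p) = (\<Sum>m\<in>Poly_Mapping.keys p.
      Poly_Mapping.lookup (Poly_Mapping.single 0 c * p) m *
        (\<Prod>x\<in>Poly_Mapping.keys m. v x ^ Poly_Mapping.lookup m x))"
    by (rule mpoly_eval_superset) (auto intro: keys_scale[THEN subsetD])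
  then show ?thesis by (simp add: lookup_scale mpoly_eval_def sum_distrib_left mult.assoc)
qed

lemma degree_monom_on_line_le:
  "degree (\<Prod>x\<in>Poly_Mapping.keys m. [:v x, w x:] ^ Poly_Mapping.lookup m x) \<le> monom_deg m"
  for v w :: "'v \<Rightarrow> 'l::field"
proof -
  have "degree (\<Prod>x\<in>Poly_Mapping.keys m. [:v x, w x:] ^ Poly_Mapping.lookup m x)
      \<le> (\<Sum>x\<in>Poly_Mapping.keys m. degree ([:v x, w x:] ^ Poly_Mapping.lookup m x))"
    using degree_prod_sum_le[OF finite_keys[of m], of "\<lambda>x. [:v x, w x:] ^ Poly_Mapping.lookup m x"]
    by (simp add: comp_def)
  also have "\<dots> \<le> (\<Sum>x\<in>Poly_Mapping.keys m. Poly_Mapping.lookup m x)"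
  proof (rule sum_mono)
    fix x
    have "degree ([:v x, w x:] ^ Poly_Mapping.lookup m x) \<le> degree [:v x, w x:] * Poly_Mapping.lookup m x"
      by (rule degree_power_le)
    also have "\<dots> \<le> 1 * Poly_Mapping.lookup m x" by (intro mult_le_mono1) simp
    finally show "degree ([:v x, w x:] ^ Poly_Mapping.lookup m x) \<le> Poly_Mapping.lookup m x" by simp
  qed
  finally show ?thesis by (simp add: monom_deg_def)
qed

lemma mpoly_eval_line:
  fixes p :: "('v, 'l::field) mpoly"
  assumes "total_degree p \<le> a"
  obtains q where "degree q \<le> a" "\<And>s. mpoly_eval (\<lambda>x. v x + s * w x) p = poly q s"
proof
  let ?q = "\<Sum>m\<in>Poly_Mapping.keys p. smult (Poly_Mapping.lookup p m)
      (\<Prod>x\<in>Poly_Mapping.keys m. [:v x, w x:] ^ Poly_Mapping.lookup m x)"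
  show "degree ?q \<le> a"
    using assms unfolding total_degree_le_iff
    by (intro degree_sum_le) (auto intro: order_trans[OF degree_smult_le] order_trans[OF degree_monom_on_line_le])
  show "mpoly_eval (\<lambda>x. v x + s * w x) p = poly ?q s" for s
    by (simp add: mpoly_eval_def poly_sum poly_prod poly_power)
qed

subsection \<open>Interpolation\<close>

lemma poly_conv_sum: "degree q \<le> a \<Longrightarrow> poly q x = (\<Sum>k\<le>a. coeff q k * x ^ k)"
  for q :: "'a::comm_ring_1 poly"
  unfolding poly_altdef by (rule sum.mono_neutral_left) (auto simp: coeff_eq_0)

text \<open>The reconstruction identity is between polynomials, not values, so that every
  coefficient of \<open>q\<close> becomes a fixed linear combination of its values on
  \<open>C\<close>.\<close>

lemma lagrange_basis:
  fixes C :: "'l::field set"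
  assumes C: "finite C" "card C = Suc D"
  obtains L :: "'l \<Rightarrow> 'l poly" where "\<And>b. b \<in> C \<Longrightarrow> degree (L b) \<le> D"
    "\<And>q. degree q \<le> D \<Longrightarrow> q = (\<Sum>b\<in>C. smult (poly q b) (L b))"
proof
  define N where "N b = (\<Prod>c\<in>C - {b}. [:- c, 1:])" for b
  define L where "L b = smult (1 / poly (N b) b) (N b)" for b
  have deg: "degree (L b) \<le> D" if "b \<in> C" for b
  proof -
    have "degree (N b) \<le> (\<Sum>c\<in>C - {b}. degree [:- c, 1:])"
      unfolding N_def using degree_prod_sum_le[of "C - {b}" "\<lambda>c. [:- c, 1:]"] C by (simp add: comp_def)
    also have "\<dots> = D" using C that by simp
    finally show ?thesis using degree_smult_le[of "1 / poly (N b) b" "N b"] by (simp add: L_def)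
  qed
  then show "\<And>b. b \<in> C \<Longrightarrow> degree (L b) \<le> D" .
  fix q :: "'l poly" assume q: "degree q \<le> D"
  have L: "poly (L b) c = (if c = b then 1 else 0)" if "b \<in> C" "c \<in> C" for b c
  proof -
    have "poly (N b) b \<noteq> 0" using C by (simp add: N_def poly_prod)
    moreover have "poly (N b) c = 0" if "c \<noteq> b"
      using C \<open>c \<in> C\<close> that by (auto simp: N_def poly_prod)
    ultimately show ?thesis by (simp add: L_def)
  qed
  show "q = (\<Sum>b\<in>C. smult (poly q b) (L b))"
  proof (rule poly_eqI_degree[of C])
    fix c assume c: "c \<in> C"
    have "poly (\<Sum>b\<in>C. smult (poly q b) (L b)) c = (\<Sum>b\<in>C. if b = c then poly q c else 0)"
      unfolding poly_sum using c by (intro sum.cong refl) (auto simp: L)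
    then show "poly q c = poly (\<Sum>b\<in>C. smult (poly q b) (L b)) c" using C c by simp
  next
    have "degree (\<Sum>b\<in>C. smult (poly q b) (L b)) \<le> D"
      using C deg by (intro degree_sum_le) (auto intro: order_trans[OF degree_smult_le])
    then show "degree (\<Sum>b\<in>C. smult (poly q b) (L b)) < card C" "degree q < card C"
      using C q by auto
  qed
qed

text \<open>Multiplying by \<open>u ^ a\<close> clears the denominators of
  \<open>poly q (y / u)\<close>; in this way Laurent polynomials with a pole of order at most
  \<open>a\<close> are handled as ordinary polynomials.\<close>

lemma poly_inverse_arg:
  fixes q :: "'l::field poly"
  assumes "degree q \<le> a"
  obtains r where "degree r \<le> a" "\<And>u. u \<noteq> 0 \<Longrightarrow> poly r u = u ^ a * poly q (y / u)"
proof
  let ?r = "\<Sum>k\<le>a. monom (coeff q k * y ^ k) (a - k)"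
  show "degree ?r \<le> a"
    by (intro degree_sum_le) (auto intro: order_trans[OF degree_monom_le])
  show "poly ?r u = u ^ a * poly q (y / u)" if "u \<noteq> 0" for u
    unfolding poly_sum poly_conv_sum[OF assms] sum_distrib_left
    using that by (intro sum.cong refl) (auto simp: poly_monom power_diff power_divide)
qed

lemma poly_scale_arg:
  fixes q :: "'l::field poly"
  assumes "degree q \<le> a"
  obtains r where "degree r \<le> a" "\<And>u. poly r u = poly q (y * u)"
    "\<And>k. coeff r k = y ^ k * coeff q k"
proof
  let ?r = "\<Sum>k\<le>a. monom (y ^ k * coeff q k) k"
  show "degree ?r \<le> a"
    by (intro degree_sum_le) (auto intro: order_trans[OF degree_monom_le])
  show "poly ?r u = poly q (y * u)" for u
    unfolding poly_sum poly_conv_sum[OF assms]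
    by (intro sum.cong refl) (auto simp: poly_monom power_mult_distrib)
  show "coeff ?r k = y ^ k * coeff q k" for k
    using assms by (auto simp: coeff_sum coeff_eq_0)
qed

text \<open>Interpolation in \<open>x\<close> at \<open>Suc a\<close> points writes
  \<open>\<phi>\<close> as a sum of products of one-variable polynomials of degree at most
  \<open>a\<close>. After substituting \<open>u * x0\<close> and \<open>y0 / u\<close> and clearing
  denominators, each of the two factors has degree at most \<open>a\<close> in
  \<open>u\<close>.\<close>

lemma biseparate_polynomial:
  fixes \<phi> :: "'l::field \<Rightarrow> 'l \<Rightarrow> 'l" and C :: "'l set"
  assumes C: "finite C" "card C = Suc a"
    and x: "\<And>y. \<exists>q. degree q \<le> a \<and> (\<forall>x. \<phi> x y = poly q x)"
    and y: "\<And>x. \<exists>q. degree q \<le> a \<and> (\<forall>y. \<phi> x y = poly q y)"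
  obtains q where "degree q \<le> 2 * a" "\<And>u. u \<noteq> 0 \<Longrightarrow> poly q u = u ^ a * \<phi> (u * x0) (y0 / u)"
proof -
  obtain L :: "'l \<Rightarrow> 'l poly" where L: "\<And>b. b \<in> C \<Longrightarrow> degree (L b) \<le> a"
    "\<And>q. degree q \<le> a \<Longrightarrow> q = (\<Sum>b\<in>C. smult (poly q b) (L b))"
    using C by (rule lagrange_basis) blast
  have exp: "\<phi> x y = (\<Sum>b\<in>C. \<phi> b y * poly (L b) x)" for x y
  proof -
    obtain q where q: "degree q \<le> a" "\<And>x. \<phi> x y = poly q x" using x by metis
    then show ?thesis using L(2)[OF q(1)] by (metis (no_types, lifting) poly_smult poly_sum sum.cong)
  qed
  have "\<exists>r. degree r \<le> a \<and> (\<forall>u. u \<noteq> 0 \<longrightarrow> poly r u = u ^ a * \<phi> b (y0 / u))" for b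
  proof -
    obtain q where q: "degree q \<le> a" "\<And>y. \<phi> b y = poly q y" using y by metis
    obtain r where "degree r \<le> a" "\<And>u. u \<noteq> 0 \<Longrightarrow> poly r u = u ^ a * poly q (y0 / u)"
      using q(1) by (rule poly_inverse_arg) blast
    then show ?thesis using q(2) by auto
  qed
  then obtain R where R: "\<And>b. degree (R b) \<le> a" "\<And>b u. u \<noteq> 0 \<Longrightarrow> poly (R b) u = u ^ a * \<phi> b (y0 / u)"
    by metis
  have "\<exists>r. degree r \<le> a \<and> (\<forall>u. poly r u = poly (L b) (x0 * u))" if "b \<in> C" for b
    using L(1)[OF that] by (rule poly_scale_arg) blast
  then obtain S where S: "\<And>b. b \<in> C \<Longrightarrow> degree (S b) \<le> a"
    "\<And>b u. b \<in> C \<Longrightarrow> poly (S b) u = poly (L b) (x0 * u)"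
    by metis
  show ?thesis
  proof
    show "degree (\<Sum>b\<in>C. R b * S b) \<le> 2 * a"
      using C R(1) S(1)
      by (intro degree_sum_le) (auto intro!: order_trans[OF degree_mult_le] simp: mult_2 add_mono)
    show "poly (\<Sum>b\<in>C. R b * S b) u = u ^ a * \<phi> (u * x0) (y0 / u)" if "u \<noteq> 0" for u
      unfolding exp[of "u * x0"] poly_sum sum_distrib_left
      using that R(2) S(2) by (intro sum.cong refl) (auto simp: mult_ac)
  qed
qed

subsection \<open>Weakly polynomial functions\<close>

interpretation fun_vs: vector_space "\<lambda>(c::'l::field) (w::'v \<Rightarrow> 'l). \<lambda>x. c * w x"
  by unfold_locales (auto simp: fun_eq_iff algebra_simps)

lemma weakly_polynomial_line:
  fixes f :: "('v \<Rightarrow> 'l::field) \<Rightarrow> 'l"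
  assumes f: "weakly_polynomial a I X f" and X: "\<And>s. (\<lambda>x. v x + s * w x) \<in> X"
  obtains q where "degree q \<le> a" "\<And>s. f (\<lambda>x. v x + s * w x) = poly q s"
proof -
  let ?U = "(\<lambda>s x. s * w x) ` UNIV"
  let ?L = "(\<lambda>u. v + u) ` ?U"
  have "fun_vs.subspace ?U"
    unfolding fun_vs.subspace_def
  proof (intro conjI ballI allI)
    show "0 \<in> ?U" by (rule image_eqI[of _ _ 0]) (simp_all add: fun_eq_iff)
    fix y z assume "y \<in> ?U" and "z \<in> ?U"
    then obtain s s' where s: "y = (\<lambda>x. s * w x)" "z = (\<lambda>x. s' * w x)" by auto
    show "y + z \<in> ?U"
      by (rule image_eqI[of _ _ "s + s'"]) (simp_all add: fun_eq_iff distrib_right s)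
  next
    fix y c assume "y \<in> ?U"
    then obtain s where s: "y = (\<lambda>x. s * w x)" by auto
    have "(\<lambda>x. c * y x) = (\<lambda>x. (c * s) * w x)"
      unfolding s by (rule ext) (rule mult.assoc[symmetric])
    then show "(\<lambda>x. c * y x) \<in> ?U" by (metis rangeI)
  qed
  then have "is_affine_subspace ?L" unfolding is_affine_subspace_def by blast
  moreover have L: "?L = range (\<lambda>s x. v x + s * w x)"
    unfolding image_image by (intro image_cong refl) (simp add: fun_eq_iff)
  then have "?L \<subseteq> X" using X by auto
  ultimately have "polynomial_on a I ?L f" using f unfolding weakly_polynomial_def by blast
  then obtain p where p: "total_degree p \<le> a" "\<And>s. f (\<lambda>x. v x + s * w x) = mpoly_eval (\<lambda>x. v x + s * w x) p"
    unfolding L polynomial_on_def by auto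
  obtain q where "degree q \<le> a" "\<And>s. mpoly_eval (\<lambda>x. v x + s * w x) p = poly q s"
    using p(1) by (rule mpoly_eval_line[where v = v and w = w]) blast
  then show ?thesis using that p(2) by auto
qed

lemma polynomial_on_sum:
  assumes "finite A" "\<And>b. b \<in> A \<Longrightarrow> polynomial_on a I S (f b)"
  shows "polynomial_on a I S (\<lambda>v. \<Sum>b\<in>A. c b * f b v)"
proof -
  obtain p where p: "\<And>b. b \<in> A \<Longrightarrow> mvars (p b) \<subseteq> I \<and> total_degree (p b) \<le> a \<and> (\<forall>v\<in>S. f b v = mpoly_eval v (p b))"
    using assms(2) unfolding polynomial_on_def by metis
  let ?P = "\<Sum>b\<in>A. Poly_Mapping.single 0 (c b) * p b"
  have k: "Poly_Mapping.keys ?P \<subseteq> (\<Union>b\<in>A. Poly_Mapping.keys (p b))"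
    using keys_sum_subset[of "\<lambda>b. Poly_Mapping.single 0 (c b) * p b" A] keys_scale by blast
  have "mvars ?P \<subseteq> I" using k p unfolding mvars_subset_iff by blast
  moreover have "total_degree ?P \<le> a" using k p unfolding total_degree_le_iff by blast
  moreover have "\<forall>v\<in>S. (\<Sum>b\<in>A. c b * f b v) = mpoly_eval v ?P"
    using p by (auto simp: mpoly_eval_sum mpoly_eval_scale intro!: sum.cong)
  ultimately show ?thesis unfolding polynomial_on_def by blast
qed

definition act :: "('v \<Rightarrow> 'l::field) \<Rightarrow> ('v \<Rightarrow> 'l) \<Rightarrow> 'v \<Rightarrow> 'l" where
  "act t v = (\<lambda>x. t x * v x)"

lemma act_commute: "act t (act t' v) = act t' (act t v)"
  by (simp add: act_def fun_eq_iff mult.left_commute)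

lemma mpoly_eval_act:
  fixes p :: "('v, 'l::field) mpoly"
  assumes "finite I" "mvars p \<subseteq> I" "total_degree p \<le> a"
  obtains p' where "mvars p' \<subseteq> I" "total_degree p' \<le> a" "\<And>v. mpoly_eval v p' = mpoly_eval (act t v) p"
proof
  let ?p = "\<Sum>m\<in>Poly_Mapping.keys p. Poly_Mapping.single m
     (Poly_Mapping.lookup p m * (\<Prod>x\<in>Poly_Mapping.keys m. t x ^ Poly_Mapping.lookup m x))"
  have k: "Poly_Mapping.keys ?p \<subseteq> Poly_Mapping.keys p"
    by (rule order_trans[OF keys_sum_subset]) (auto split: if_splits)
  show "mvars ?p \<subseteq> I" using k assms(2) unfolding mvars_subset_iff by blast
  show "total_degree ?p \<le> a" using k assms(3) unfolding total_degree_le_iff by blast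
  show "mpoly_eval v ?p = mpoly_eval (act t v) p" for v
    unfolding mpoly_eval_sum mpoly_eval_single mpoly_eval_def[of "act t v"]
    by (simp add: act_def power_mult_distrib prod.distrib mult.assoc)
qed

text \<open>Scaling coordinates is linear, hence maps affine subspaces inside \<open>X\<close> to
  affine subspaces inside \<open>X\<close>, and substituting it into a polynomial does not raise the
  degree. This makes the eigencomponents weakly polynomial again.\<close>

lemma weakly_polynomial_sum_act:
  fixes f :: "('v \<Rightarrow> 'l::field) \<Rightarrow> 'l"
  assumes f: "weakly_polynomial a I X f" and I: "finite I" and A: "finite A"
    and t: "\<And>b v. b \<in> A \<Longrightarrow> v \<in> X \<Longrightarrow> act (t b) v \<in> X"
  shows "weakly_polynomial a I X (\<lambda>v. \<Sum>b\<in>A. c b * f (act (t b) v))"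
  unfolding weakly_polynomial_def
proof (intro allI impI)
  fix L assume L: "is_affine_subspace L \<and> L \<subseteq> X"
  then obtain v U where U: "fun_vs.subspace U" "L = (\<lambda>u. v + u) ` U"
    unfolding is_affine_subspace_def by blast
  have "polynomial_on a I L (\<lambda>v. f (act (t b) v))" if b: "b \<in> A" for b
  proof -
    have "fun_vs.subspace (act (t b) ` U)"
      unfolding fun_vs.subspace_def
    proof (intro conjI ballI allI)
      show "0 \<in> act (t b) ` U"
        by (rule image_eqI[OF _ fun_vs.subspace_0[OF U(1)]]) (auto simp: act_def fun_eq_iff)
      fix y z assume "y \<in> act (t b) ` U" and "z \<in> act (t b) ` U"
      then obtain s s' where s: "y = act (t b) s" "s \<in> U" "z = act (t b) s'" "s' \<in> U" by auto
      show "y + z \<in> act (t b) ` U"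
        by (rule image_eqI[OF _ fun_vs.subspace_add[OF U(1) s(2,4)]])
           (auto simp: act_def fun_eq_iff algebra_simps s)
    next
      fix y c assume "y \<in> act (t b) ` U"
      then obtain s where s: "y = act (t b) s" "s \<in> U" by auto
      have "(\<lambda>x. c * y x) = act (t b) (\<lambda>x. c * s x)"
        unfolding s act_def by (rule ext) (rule mult.left_commute)
      then show "(\<lambda>x. c * y x) \<in> act (t b) ` U"
        using fun_vs.subspace_scale[OF U(1) s(2), of c] by (metis imageI)
    qed
    moreover have "act (t b) ` L = (\<lambda>u. act (t b) v + u) ` (act (t b) ` U)"
      unfolding U(2) image_image by (intro image_cong refl) (auto simp: act_def fun_eq_iff algebra_simps)
    ultimately have "is_affine_subspace (act (t b) ` L)" unfolding is_affine_subspace_def by blast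
    moreover have "act (t b) ` L \<subseteq> X" using L t b by blast
    ultimately have "polynomial_on a I (act (t b) ` L) f" using f unfolding weakly_polynomial_def by blast
    then obtain p where p: "mvars p \<subseteq> I" "total_degree p \<le> a"
      "\<And>v. v \<in> L \<Longrightarrow> f (act (t b) v) = mpoly_eval (act (t b) v) p"
      unfolding polynomial_on_def by auto
    obtain p' where "mvars p' \<subseteq> I" "total_degree p' \<le> a" "\<And>v. mpoly_eval v p' = mpoly_eval (act (t b) v) p"
      using I p(1,2) by (rule mpoly_eval_act[where t = "t b"]) blast
    then show ?thesis unfolding polynomial_on_def using p(3) by metis
  qed
  then show "polynomial_on a I L (\<lambda>v. \<Sum>b\<in>A. c b * f (act (t b) v))"
    by (rule polynomial_on_sum[OF A])
qed

subsection \<open>The torus action on the hypersurface\<close>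

text \<open>The zero locus given directly by its equation over the larger field;
  \<open>hypersurface_points_Pn\<close> identifies it with the points defined through the
  embedding.\<close>

definition Xn :: "nat \<Rightarrow> nat \<Rightarrow> (nat \<times> nat \<Rightarrow> 'l::field) set" where
  "Xn d n = {v \<in> affine_points (coords d n). (\<Sum>i<n. \<Prod>j<d. v (i, j)) = 0}"

abbreviation row_cofactor :: "nat \<Rightarrow> (nat \<times> nat \<Rightarrow> 'l::field) \<Rightarrow> nat \<Rightarrow> nat \<Rightarrow> 'l" where
  "row_cofactor d v i j \<equiv> \<Prod>j'\<in>{..<d} - {j}. v (i, j')"

lemma row_prod_remove: "j < d \<Longrightarrow> (\<Prod>j<d. v (i, j)) = v (i, j) * row_cofactor d v i j"
  by (rule prod.remove) auto

lemma row_prod_upd: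
  assumes "j < d"
  shows "(\<Prod>j'<d. (v((i, j) := y)) (i', j')) = (if i' = i then y * row_cofactor d v i j else (\<Prod>j'<d. v (i', j')))"
proof (cases "i' = i")
  case True
  have "(\<Prod>j'\<in>{..<d} - {j}. (v((i, j) := y)) (i, j')) = row_cofactor d v i j"
    by (rule prod.cong) auto
  then show ?thesis using True row_prod_remove[OF assms, of "v((i, j) := y)" i] by simp
qed simp

text \<open>The product of row \<open>i\<close> is zero whatever stands at \<open>(i, j)\<close>, so
  the whole coordinate line stays on the hypersurface.\<close>

lemma Xn_upd:
  fixes v :: "nat \<times> nat \<Rightarrow> 'l::field"
  assumes "v \<in> Xn d n" "i < n" "j < d" "row_cofactor d v i j = 0"
  shows "v((i, j) := y) \<in> Xn d n"
proof -
  have "(\<Prod>j'<d. (v((i, j) := y)) (i', j')) = (\<Prod>j'<d. v (i', j'))" for i'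
    using row_prod_upd[of j d v i y i'] row_prod_remove[of j d v i] assms
    by (simp del: prod_zero_iff fun_upd_apply)
  then show ?thesis using assms(1-3) by (auto simp: Xn_def affine_points_def coords_def)
qed

lemma Xn_act:
  assumes "v \<in> Xn d n" "\<And>i. i < n \<Longrightarrow> (\<Prod>j<d. t (i, j)) = 1"
  shows "act t v \<in> Xn d n"
proof -
  have "(\<Sum>i<n. \<Prod>j<d. act t v (i, j)) = (\<Sum>i<n. \<Prod>j<d. v (i, j))"
    using assms(2) by (intro sum.cong refl) (simp add: act_def prod.distrib)
  then show ?thesis using assms(1) by (auto simp: Xn_def affine_points_def act_def)
qed

text \<open>For a column other than \<open>0\<close> and \<open>u \<noteq> 0\<close>, column
  \<open>0\<close> compensates for the factor \<open>u\<close>, so that all row products are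
  \<open>1\<close>. These subgroups generate the torus.\<close>

definition one_param :: "nat \<times> nat \<Rightarrow> 'l::field \<Rightarrow> nat \<times> nat \<Rightarrow> 'l" where
  "one_param \<kappa> u = (\<lambda>x. if x = \<kappa> then u else if x = (fst \<kappa>, 0) then 1 / u else 1)"

lemma one_param_row_prod:
  assumes "j0 < d" "0 < j0" "u \<noteq> 0"
  shows "(\<Prod>j<d. one_param (i0, j0) u (i, j)) = 1"
proof (cases "i = i0")
  case True
  have "(\<Prod>j<d. one_param (i0, j0) u (i, j)) = (\<Prod>j\<in>{0, j0}. one_param (i0, j0) u (i, j))"
    by (rule prod.mono_neutral_right) (use assms True in \<open>auto simp: one_param_def\<close>)
  then show ?thesis using assms True by (simp add: one_param_def)
qed (simp add: one_param_def)

lemma act_one_param_mult: "act (one_param \<kappa> u) (act (one_param \<kappa> w) v) = act (one_param \<kappa> (u * w)) v"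
  by (auto simp: act_def one_param_def fun_eq_iff)

lemma act_one_param_1 [simp]: "act (one_param \<kappa> 1) v = v"
  by (auto simp: act_def one_param_def fun_eq_iff)

lemma act_one_param_conv:
  "0 < j \<Longrightarrow> act (one_param (i, j) u) v = v((i, j) := u * v (i, j), (i, 0) := v (i, 0) / u)"
  by (auto simp: act_def one_param_def fun_eq_iff)

lemma weakly_polynomial_coordinate:
  fixes f :: "(nat \<times> nat \<Rightarrow> 'l::field) \<Rightarrow> 'l"
  assumes f: "weakly_polynomial a (coords d n) (Xn d n) f"
    and v: "v \<in> Xn d n" "i < n" "j < d" "row_cofactor d v i j = 0"
  obtains q where "degree q \<le> a" "\<And>y. f (v((i, j) := y)) = poly q y"
proof -
  have line: "v((i, j) := s) = (\<lambda>x. (v((i, j) := 0)) x + s * (if x = (i, j) then 1 else 0))" for s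
    by (auto simp: fun_eq_iff)
  have "(\<lambda>x. (v((i, j) := 0)) x + s * (if x = (i, j) then 1 else 0)) \<in> Xn d n" for s
    using Xn_upd[OF v] unfolding line[symmetric] .
  then obtain q where "degree q \<le> a" "\<And>s. f (\<lambda>x. (v((i, j) := 0)) x + s * (if x = (i, j) then 1 else 0)) = poly q s"
    by (rule weakly_polynomial_line[OF f]) blast
  then show ?thesis using that unfolding line[symmetric] by blast
qed

text \<open>After multiplication by \<open>u ^ a\<close>, Laurent polynomials with exponents in
  \<open>[-a, a]\<close> become polynomials of degree at most \<open>2 * a\<close>, which
  \<open>2 * a + 1\<close> nonzero points determine.\<close>

locale large_field =
  fixes a :: nat and C :: "'l::field set"
  assumes C: "finite C" "card C = Suc (2 * a)" "0 \<notin> C"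
begin

lemma poly_eqI_nonzero:
  assumes "degree p \<le> 2 * a" "degree q \<le> 2 * a" "\<And>u :: 'l. u \<noteq> 0 \<Longrightarrow> poly p u = poly q u"
  shows "p = q"
proof (rule poly_eqI_degree[of C])
  fix u assume "u \<in> C"
  then show "poly p u = poly q u" using assms(3) C(3) by metis
qed (use assms C in auto)

text \<open>The compensating coordinate \<open>z\<close> in another row keeps the point on the hypersurface while \<open>x\<close> and
  \<open>y\<close> vary independently.  If there is none, then row \<open>i\<close> has product zero and one of the three factors
  \<open>v (i, j)\<close>, \<open>v (i, 0)\<close>, \<open>R\<close> vanishes; in the case \<open>R = 0\<close> a dummy \<open>z\<close> outside the coordinates will do.\<close>

lemma laurent_along_one_param:
  fixes f :: "(nat \<times> nat \<Rightarrow> 'l) \<Rightarrow> 'l"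
  assumes f: "weakly_polynomial a (coords d n) (Xn d n) f"
    and v: "v \<in> Xn d n" "i < n" "j < d" "0 < j"
  obtains q where "degree q \<le> 2 * a" "\<And>u. u \<noteq> 0 \<Longrightarrow> poly q u = u ^ a * f (act (one_param (i, j) u) v)"
proof -
  define R where "R = (\<Prod>j'\<in>{..<d} - {j} - {0}. v (i, j'))"
  \<comment> \<open>With \<open>x\<close> or \<open>y\<close> fixed the point runs along a line in
    the other variable, as \<open>biseparate_polynomial\<close> requires. The coordinate at
    \<open>z\<close> may contain the mixed term \<open>x * y\<close>, so both together need not
    sweep out a plane.\<close>
  define pt where "pt z K M x y = v((i, j) := x, (i, 0) := y, z := K - x * y * M)" for z K M x y
  have R1: "row_cofactor d v i j = v (i, 0) * R"
    unfolding R_def using v by (intro prod.remove) auto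
  have R2: "row_cofactor d v i 0 = v (i, j) * R"
  proof -
    have "row_cofactor d v i 0 = v (i, j) * (\<Prod>j'\<in>{..<d} - {0} - {j}. v (i, j'))"
      using v by (intro prod.remove) auto
    also have "{..<d} - {0} - {j} = {..<d} - {j} - {0}" by auto
    finally show ?thesis by (simp add: R_def)
  qed
  have rowi: "(\<Prod>j'<d. v (i, j')) = v (i, j) * v (i, 0) * R"
    using row_prod_remove[of j d v i] R1 v by simp
  have row2: "(\<Prod>j'<d. (v((i, j) := x, (i, 0) := y)) (i', j')) =
      (if i' = i then x * y * R else (\<Prod>j'<d. v (i', j')))" for x y i'
  proof -
    have "row_cofactor d (v((i, j) := x)) i 0 = x * R"
    proof -
      have "row_cofactor d (v((i, j) := x)) i 0 = x * (\<Prod>j'\<in>{..<d} - {0} - {j}. (v((i, j) := x)) (i, j'))"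
        using v by (subst prod.remove[of _ j]) auto
      also have "(\<Prod>j'\<in>{..<d} - {0} - {j}. (v((i, j) := x)) (i, j')) = R"
        unfolding R_def by (rule prod.cong) auto
      finally show ?thesis .
    qed
    then show ?thesis
      using row_prod_upd[of 0 d "v((i, j) := x)" i y i'] row_prod_upd[of j d v i x i'] v
      by (simp add: mult_ac)
  qed
  note found = that
  have main: thesis if z: "fst z \<noteq> i" and X: "\<And>x y. pt z K M x y \<in> Xn d n"
    and K: "K - v (i, j) * v (i, 0) * M = v z" for z K M
  proof -
    obtain C' where C': "finite C'" "card C' = Suc a" "C' \<subseteq> C"
      using C by (metis obtain_subset_with_card_n le_add1 mult_2 Suc_le_mono finite_subset)
    have "\<exists>q. degree q \<le> a \<and> (\<forall>x. f (pt z K M x y) = poly q x)" for y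
    proof -
      have l: "(\<lambda>p. pt z K M 0 y p + x * (if p = (i, j) then 1 else if p = z then - y * M else 0)) = pt z K M x y" for x
        using z v by (auto simp: pt_def fun_eq_iff)
      show ?thesis
        by (rule weakly_polynomial_line[OF f, of "pt z K M 0 y" "\<lambda>p. if p = (i, j) then 1 else if p = z then - y * M else 0"])
           (use X in \<open>auto simp only: l\<close>)
    qed
    moreover have "\<exists>q. degree q \<le> a \<and> (\<forall>y. f (pt z K M x y) = poly q y)" for x
    proof -
      have l: "(\<lambda>p. pt z K M x 0 p + y * (if p = (i, 0) then 1 else if p = z then - x * M else 0)) = pt z K M x y" for y
        using z v by (auto simp: pt_def fun_eq_iff)
      show ?thesis
        by (rule weakly_polynomial_line[OF f, of "pt z K M x 0" "\<lambda>p. if p = (i, 0) then 1 else if p = z then - x * M else 0"])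
           (use X in \<open>auto simp only: l\<close>)
    qed
    ultimately obtain q where q: "degree q \<le> 2 * a"
      "\<And>u. u \<noteq> 0 \<Longrightarrow> poly q u = u ^ a * f (pt z K M (u * v (i, j)) (v (i, 0) / u))"
      using biseparate_polynomial[OF C'(1,2), of "\<lambda>x y. f (pt z K M x y)"] by blast
    have "pt z K M (u * v (i, j)) (v (i, 0) / u) = act (one_param (i, j) u) v" if "u \<noteq> 0" for u
      using that v z K by (auto simp: act_one_param_conv pt_def fun_eq_iff)
    then show thesis using q by (intro found[of q]) auto
  qed
  consider (R) "R = 0" | (other) i0 j0 where "i0 < n" "i0 \<noteq> i" "j0 < d" "row_cofactor d v i0 j0 \<noteq> 0"
    | (zero) "\<forall>i0<n. i0 \<noteq> i \<longrightarrow> (\<forall>j0<d. row_cofactor d v i0 j0 = 0)" "R \<noteq> 0"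
    by (cases "R = 0"; cases "\<exists>i0 j0. i0 < n \<and> i0 \<noteq> i \<and> j0 < d \<and> row_cofactor d v i0 j0 \<noteq> 0")
       (simp_all only: not_ex de_Morgan_conj not_not, metis+)
  then show thesis
  proof cases
    case R
    have "pt (n, 0) 0 0 x y \<in> Xn d n" for x y
    proof -
      have "(pt (n, 0) 0 0 x y) = v((i, j) := x, (i, 0) := y)"
        using v by (auto simp: pt_def fun_eq_iff Xn_def affine_points_def coords_def)
      moreover have "(\<Prod>j'<d. (v((i, j) := x, (i, 0) := y)) (i', j')) = (\<Prod>j'<d. v (i', j'))" for i'
        using row2[of x y i'] R rowi by simp
      ultimately show ?thesis
        using v by (auto simp: Xn_def affine_points_def coords_def)
    qed
    moreover have "v (n, 0) = 0" using v by (auto simp: Xn_def affine_points_def coords_def)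
    ultimately show thesis using v by (intro main[of "(n, 0)" 0 0]) auto
  next
    case other
    define p where "p = row_cofactor d v i0 j0"
    have p: "p \<noteq> 0" using other by (simp add: p_def)
    \<comment> \<open>The change of \<open>x * y * R\<close> in row \<open>i\<close> is cancelled by
      \<open>- x * y * M * p\<close> in row \<open>i0\<close>; \<open>K\<close> restores
      \<open>v (i0, j0)\<close> at the original values of \<open>x\<close> and
      \<open>y\<close>.\<close>
    define M where "M = R / p"
    define K where "K = v (i0, j0) + v (i, j) * v (i, 0) * M"
    have "pt (i0, j0) K M x y \<in> Xn d n" for x y
    proof -
      let ?w = "v((i, j) := x, (i, 0) := y)"
      have pt: "pt (i0, j0) K M x y = ?w((i0, j0) := K - x * y * M)" by (simp add: pt_def)
      have "row_cofactor d ?w i0 j0 = p"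
        unfolding p_def using other by (intro prod.cong) auto
      then have r0: "(\<Prod>j'<d. pt (i0, j0) K M x y (i', j')) =
          (if i' = i0 then (K - x * y * M) * p else if i' = i then x * y * R else (\<Prod>j'<d. v (i', j')))" for i'
        unfolding pt row_prod_upd[OF other(3)] row2 by auto
      have "(\<Sum>i<n. \<Prod>j<d. v (i, j)) = (\<Prod>j<d. v (i0, j)) + ((\<Prod>j<d. v (i, j)) + (\<Sum>i'\<in>{..<n} - {i0} - {i}. \<Prod>j<d. v (i', j)))"
        using other v by (subst sum.remove[of _ i0], simp, simp, subst sum.remove[of _ i]) auto
      then have "(\<Sum>i'\<in>{..<n} - {i0} - {i}. \<Prod>j<d. v (i', j)) = - (v (i0, j0) * p) - v (i, j) * v (i, 0) * R"
        using v row_prod_remove[OF other(3), of v i0] rowi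
        by (simp add: Xn_def p_def algebra_simps eq_neg_iff_add_eq_0)
      moreover have "(\<Sum>i'<n. \<Prod>j'<d. pt (i0, j0) K M x y (i', j')) =
          (K - x * y * M) * p + (x * y * R + (\<Sum>i'\<in>{..<n} - {i0} - {i}. \<Prod>j<d. v (i', j)))"
        unfolding r0 using other v
        by (subst sum.remove[of _ i0], simp, simp, subst sum.remove[of _ i]) auto
      ultimately have "(\<Sum>i'<n. \<Prod>j'<d. pt (i0, j0) K M x y (i', j')) = 0"
        using p by (simp add: K_def M_def algebra_simps)
      moreover have "pt (i0, j0) K M x y \<in> affine_points (coords d n)"
        using v other by (auto simp: pt_def Xn_def affine_points_def coords_def)
      ultimately show ?thesis by (simp add: Xn_def)
    qed
    then show thesis using other by (intro main[of "(i0, j0)" K M]) (auto simp: K_def)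
  next
    case zero
    have z: "(\<Prod>j'<d. v (i', j')) = 0" if "i' < n" "i' \<noteq> i" for i'
      using row_prod_remove[of j d v i'] zero(1) v that by simp
    have "(\<Sum>i'\<in>{..<n} - {i}. \<Prod>j'<d. v (i', j')) = 0"
      by (rule sum.neutral) (use z in blast)
    then have "(\<Sum>i'<n. \<Prod>j'<d. v (i', j')) = v (i, j) * v (i, 0) * R"
      using v(2) rowi sum.remove[of "{..<n}" i "\<lambda>i'. \<Prod>j'<d. v (i', j')"]
      by (simp del: prod_zero_iff)
    moreover have "(\<Sum>i'<n. \<Prod>j'<d. v (i', j')) = 0" using v(1) by (simp add: Xn_def)
    \<comment> \<open>At most one of the two coordinates now moves under the subgroup, so the orbit
      lies on a coordinate line in the hypersurface.\<close>
    ultimately have "v (i, j) = 0 \<or> v (i, 0) = 0" using zero(2) by auto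
    then show thesis
    proof
      assume x0: "v (i, j) = 0"
      then have "row_cofactor d v i 0 = 0" using R2 by simp
      then obtain q where q: "degree q \<le> a" "\<And>y. f (v((i, 0) := y)) = poly q y"
        using v(3) weakly_polynomial_coordinate[OF f v(1,2), of 0] by (metis gr_zeroI not_less_zero)
      obtain r where r: "degree r \<le> a" "\<And>u. u \<noteq> 0 \<Longrightarrow> poly r u = u ^ a * poly q (v (i, 0) / u)"
        using q(1) by (rule poly_inverse_arg) blast
      have "act (one_param (i, j) u) v = v((i, 0) := v (i, 0) / u)" for u
        using x0 v by (auto simp: act_one_param_conv fun_eq_iff)
      then show thesis using r q by (intro found[of r]) auto
    next
      assume y0: "v (i, 0) = 0"
      then have "row_cofactor d v i j = 0" using R1 by simp
      then obtain q where q: "degree q \<le> a" "\<And>y. f (v((i, j) := y)) = poly q y"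
        using weakly_polynomial_coordinate[OF f v(1-3)] by metis
      obtain r where r: "degree r \<le> a" "\<And>u. poly r u = poly q (v (i, j) * u)"
        using q(1) by (rule poly_scale_arg) blast
      have "act (one_param (i, j) u) v = v((i, j) := v (i, j) * u)" for u
        using y0 v by (auto simp: act_one_param_conv fun_eq_iff)
      moreover have "degree (monom 1 a * r) \<le> 2 * a"
        using r(1) degree_mult_le[of "monom 1 a" r] degree_monom_le[of "1::'l" a] by simp
      ultimately show thesis using r q by (intro found[of "monom 1 a * r"]) (auto simp: poly_monom)
    qed
  qed
qed

subsection \<open>Decomposition into torus eigenfunctions\<close>

text \<open>Eigenfunctions of weight \<open>e - a\<close>; the shift by \<open>a\<close> avoids negative exponents.\<close>

definition eigen_along :: "nat \<Rightarrow> nat \<Rightarrow> ((nat \<times> nat \<Rightarrow> 'l) \<Rightarrow> 'l) \<Rightarrow> nat \<times> nat \<Rightarrow> nat \<Rightarrow> bool" where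
  "eigen_along d n f \<kappa> e \<longleftrightarrow> (\<forall>v\<in>Xn d n. \<forall>u. u \<noteq> 0 \<longrightarrow> u ^ a * f (act (one_param \<kappa> u) v) = u ^ e * f v)"

text \<open>The eigencomponents are the coefficients of the Laurent polynomial above.  By Lagrange interpolation at the
  points of \<open>C\<close> they are linear combinations of translates of \<open>f\<close>, hence again weakly polynomial.\<close>

lemma eigen_decomposition_step:
  fixes f :: "(nat \<times> nat \<Rightarrow> 'l) \<Rightarrow> 'l"
  assumes f: "weakly_polynomial a (coords d n) (Xn d n) f" and \<kappa>: "\<kappa> \<in> {..<n} \<times> {1..<d}"
  obtains g where "\<And>e. weakly_polynomial a (coords d n) (Xn d n) (g e)"
    "\<And>e. eigen_along d n (g e) \<kappa> e"
    "\<And>e \<kappa>' e'. \<kappa>' \<in> {..<n} \<times> {1..<d} \<Longrightarrow> eigen_along d n f \<kappa>' e' \<Longrightarrow> eigen_along d n (g e) \<kappa>' e'"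
    "\<And>v. v \<in> Xn d n \<Longrightarrow> f v = (\<Sum>e\<le>2 * a. g e v)"
proof -
  obtain L :: "'l \<Rightarrow> 'l poly" where L: "\<And>b. b \<in> C \<Longrightarrow> degree (L b) \<le> 2 * a"
    "\<And>q. degree q \<le> 2 * a \<Longrightarrow> q = (\<Sum>b\<in>C. smult (poly q b) (L b))"
    using C(1,2) by (rule lagrange_basis) blast
  define g where "g e v = (\<Sum>b\<in>C. coeff (L b) e * b ^ a * f (act (one_param \<kappa> b) v))" for e v
  have inv: "act (one_param \<kappa>' u) v \<in> Xn d n" if "v \<in> Xn d n" "u \<noteq> 0" "\<kappa>' \<in> {..<n} \<times> {1..<d}" for v u \<kappa>'
    using that by (cases \<kappa>') (auto intro!: Xn_act one_param_row_prod)
  have ex: "\<exists>q. degree q \<le> 2 * a \<and> (\<forall>u. u \<noteq> 0 \<longrightarrow> poly q u = u ^ a * f (act (one_param \<kappa> u) v)) \<and>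
      (\<forall>e. g e v = coeff q e)" if v: "v \<in> Xn d n" for v
  proof -
    obtain q where q: "degree q \<le> 2 * a"
      "\<And>u. u \<noteq> 0 \<Longrightarrow> poly q u = u ^ a * f (act (one_param \<kappa> u) v)"
    proof -
      obtain i j where "\<kappa> = (i, j)" "i < n" "j < d" "0 < j" using \<kappa> by auto
      then show thesis using laurent_along_one_param[OF f v, of i j] that by metis
    qed
    have "g e v = coeff q e" for e
    proof -
      have "coeff q e = coeff (\<Sum>b\<in>C. smult (poly q b) (L b)) e"
        by (rule arg_cong[OF L(2)[OF q(1)]])
      also have "\<dots> = g e v"
        unfolding coeff_sum g_def
      proof (intro sum.cong refl)
        fix b assume "b \<in> C"
        then have "poly q b = b ^ a * f (act (one_param \<kappa> b) v)" using C(3) by (intro q(2)) auto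
        then show "coeff (smult (poly q b) (L b)) e = coeff (L b) e * b ^ a * f (act (one_param \<kappa> b) v)"
          by simp
      qed
      finally show ?thesis by simp
    qed
    then show ?thesis using q by blast
  qed
  show thesis
  proof
    show "weakly_polynomial a (coords d n) (Xn d n) (g e)" for e
      unfolding g_def
    proof (rule weakly_polynomial_sum_act[OF f _ C(1)])
      show "finite (coords d n)" by (simp add: coords_def)
      show "act (one_param \<kappa> b) v \<in> Xn d n" if "b \<in> C" "v \<in> Xn d n" for b v
        using that C(3) by (intro inv[OF _ _ \<kappa>]) auto
    qed
    show "eigen_along d n (g e) \<kappa> e" for e
      unfolding eigen_along_def
    proof (intro ballI allI impI)
      fix v :: "nat \<times> nat \<Rightarrow> 'l" and w :: 'l assume v: "v \<in> Xn d n" and w: "w \<noteq> 0"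
      obtain q where q: "degree q \<le> 2 * a" "\<And>u. u \<noteq> 0 \<Longrightarrow> poly q u = u ^ a * f (act (one_param \<kappa> u) v)"
        "g e v = coeff q e" using ex[OF v] by blast
      obtain q' where q': "degree q' \<le> 2 * a"
        "\<And>u. u \<noteq> 0 \<Longrightarrow> poly q' u = u ^ a * f (act (one_param \<kappa> u) (act (one_param \<kappa> w) v))"
        "g e (act (one_param \<kappa> w) v) = coeff q' e" using ex[OF inv[OF v w \<kappa>]] by blast
      obtain r where r: "degree r \<le> 2 * a" "\<And>u. poly r u = poly q (w * u)" "\<And>k. coeff r k = w ^ k * coeff q k"
        using q(1) by (rule poly_scale_arg) blast
      have "smult (w ^ a) q' = r"
      proof (rule poly_eqI_nonzero)
        fix u :: 'l assume u: "u \<noteq> 0"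
        have "poly r u = (w * u) ^ a * f (act (one_param \<kappa> (w * u)) v)"
          using u w by (simp add: r(2) q(2))
        then show "poly (smult (w ^ a) q') u = poly r u"
          using u by (simp add: q'(2) act_one_param_mult power_mult_distrib mult.assoc mult.commute[of u w])
      qed (use q' r in \<open>auto intro: order_trans[OF degree_smult_le]\<close>)
      then show "w ^ a * g e (act (one_param \<kappa> w) v) = w ^ e * g e v"
        using r(3)[of e] q(3) q'(3) by auto
    qed
    \<comment> \<open>The torus is commutative, so splitting along \<open>\<kappa>\<close> keeps the
      eigenproperties already obtained; this allows the iteration over all subgroups.\<close>
    show "eigen_along d n (g e) \<kappa>' e'" if \<kappa>': "\<kappa>' \<in> {..<n} \<times> {1..<d}" and e': "eigen_along d n f \<kappa>' e'" for e \<kappa>' e'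
      unfolding eigen_along_def
    proof (intro ballI allI impI)
      fix v :: "nat \<times> nat \<Rightarrow> 'l" and u :: 'l assume v: "v \<in> Xn d n" and u: "u \<noteq> 0"
      have ev: "u ^ a * f (act (one_param \<kappa> b) (act (one_param \<kappa>' u) v)) = u ^ e' * f (act (one_param \<kappa> b) v)"
        if "b \<in> C" for b
      proof -
        have "act (one_param \<kappa> b) v \<in> Xn d n" using that C(3) by (intro inv[OF v _ \<kappa>]) auto
        then show ?thesis
          using e' u act_commute[of "one_param \<kappa> b" "one_param \<kappa>' u" v] unfolding eigen_along_def by metis
      qed
      show "u ^ a * g e (act (one_param \<kappa>' u) v) = u ^ e' * g e v"
        unfolding g_def sum_distrib_left
        by (intro sum.cong refl)
           (simp only: mult.left_commute[of "u ^ a"] mult.left_commute[of "u ^ e'"] ev)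
    qed
    show "f v = (\<Sum>e\<le>2 * a. g e v)" if v: "v \<in> Xn d n" for v
    proof -
      obtain q where q: "degree q \<le> 2 * a" "\<And>u. u \<noteq> 0 \<Longrightarrow> poly q u = u ^ a * f (act (one_param \<kappa> u) v)"
        "\<And>e. g e v = coeff q e" using ex[OF v] by blast
      have "f v = poly q 1" using q(2)[of 1] by simp
      then show ?thesis unfolding poly_conv_sum[OF q(1)] by (simp add: q(3))
    qed
  qed
qed

definition extends :: "nat \<Rightarrow> nat \<Rightarrow> ((nat \<times> nat \<Rightarrow> 'l) \<Rightarrow> 'l) \<Rightarrow> bool" where
  "extends d n f \<longleftrightarrow> (\<exists>g. polynomial_on a (coords d n) (affine_points (coords d n)) g \<and> (\<forall>v\<in>Xn d n. f v = g v))"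

lemma extends_sum:
  fixes g :: "nat \<Rightarrow> (nat \<times> nat \<Rightarrow> 'l) \<Rightarrow> 'l"
  assumes "\<And>e. e \<in> E \<Longrightarrow> extends d n (g e)" "finite E" "\<And>v. v \<in> Xn d n \<Longrightarrow> f v = (\<Sum>e\<in>E. g e v)"
  shows "extends d n f"
proof -
  obtain h where h: "\<And>e. e \<in> E \<Longrightarrow> polynomial_on a (coords d n) (affine_points (coords d n)) (h e)"
    "\<And>e v. e \<in> E \<Longrightarrow> v \<in> Xn d n \<Longrightarrow> g e v = h e v"
    using assms(1) unfolding extends_def by metis
  have "polynomial_on a (coords d n) (affine_points (coords d n)) (\<lambda>v. \<Sum>e\<in>E. 1 * h e v)"
    using h(1) by (rule polynomial_on_sum[OF assms(2)])
  then show ?thesis unfolding extends_def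
    using assms(3) h(2) by (intro exI[of _ "\<lambda>v. \<Sum>e\<in>E. 1 * h e v"]) (auto intro!: sum.cong)
qed

text \<open>One subgroup is diagonalised after the other; \<open>K'\<close> in the induction
  collects those along which \<open>f\<close> need not be an eigenfunction yet.\<close>

lemma extends_if_eigen_extends:
  fixes f :: "(nat \<times> nat \<Rightarrow> 'l) \<Rightarrow> 'l"
  assumes eig: "\<And>f. weakly_polynomial a (coords d n) (Xn d n) f \<Longrightarrow>
      (\<forall>\<kappa>\<in>{..<n} \<times> {1..<d}. \<exists>e\<le>2 * a. eigen_along d n f \<kappa> e) \<Longrightarrow> extends d n f"
    and f: "weakly_polynomial a (coords d n) (Xn d n) f"
  shows "extends d n f"
proof -
  let ?K = "{..<n} \<times> {1..<d}"
  have *: "finite K' \<Longrightarrow> K' \<subseteq> ?K \<Longrightarrow> weakly_polynomial a (coords d n) (Xn d n) f \<Longrightarrow>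
      (\<forall>\<kappa>\<in>?K - K'. \<exists>e\<le>2 * a. eigen_along d n f \<kappa> e) \<Longrightarrow> extends d n f" for K' f
  proof (induction K' arbitrary: f rule: finite_induct)
    case empty
    then show ?case using eig by simp
  next
    case (insert \<kappa> K')
    then have \<kappa>: "\<kappa> \<in> ?K" by blast
    obtain g where g: "\<And>e. weakly_polynomial a (coords d n) (Xn d n) (g e)"
      "\<And>e. eigen_along d n (g e) \<kappa> e"
      "\<And>e \<kappa>' e'. \<kappa>' \<in> ?K \<Longrightarrow> eigen_along d n f \<kappa>' e' \<Longrightarrow> eigen_along d n (g e) \<kappa>' e'"
      "\<And>v. v \<in> Xn d n \<Longrightarrow> f v = (\<Sum>e\<le>2 * a. g e v)"
      using insert.prems(2) \<kappa> by (rule eigen_decomposition_step) blast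
    have ext: "extends d n (g e)" if e: "e \<in> {..2 * a}" for e
    proof (rule insert.IH)
      show "K' \<subseteq> ?K" using insert.prems by blast
      show "\<forall>\<kappa>'\<in>?K - K'. \<exists>e'\<le>2 * a. eigen_along d n (g e) \<kappa>' e'"
      proof
        fix \<kappa>' assume \<kappa>': "\<kappa>' \<in> ?K - K'"
        show "\<exists>e'\<le>2 * a. eigen_along d n (g e) \<kappa>' e'"
        proof (cases "\<kappa>' = \<kappa>")
          case True
          then show ?thesis using g(2)[of e] e by auto
        next
          case False
          then obtain e' where "e' \<le> 2 * a" "eigen_along d n f \<kappa>' e'"
            using insert.prems(3) \<kappa>' by blast
          then show ?thesis using g(3)[of \<kappa>' e' e] \<kappa>' by blast
        qed
      qed
    qed (rule g(1))
    show ?case by (rule extends_sum[OF ext _ g(4)]) auto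
  qed
  show ?thesis by (rule *[of ?K f]) (use f in auto)
qed

end

section \<open>The character of the full torus on an eigenfunction\<close>

lemma prod_coords: "(\<Prod>x\<in>coords d n. g x) = (\<Prod>i<n. \<Prod>j<d. g (i, j))"
  unfolding coords_def by (rule prod.cartesian_product')

lemma sum_coords: "(\<Sum>x\<in>coords d n. g x) = (\<Sum>i<n. \<Sum>j<d. g (i, j))"
  unfolding coords_def by (rule sum.cartesian_product')

lemma finite_coords [simp]: "finite (coords d n)"
  by (simp add: coords_def)

lemma act_cong_coords:
  "v \<in> Xn d n \<Longrightarrow> (\<And>x. x \<in> coords d n \<Longrightarrow> t x = t' x) \<Longrightarrow> act t v = act t' v"
  by (auto simp: Xn_def affine_points_def act_def fun_eq_iff)

text \<open>Membership in \<open>Xn d n\<close> is carried along because the eigenproperty only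
  speaks of points there; the powers \<open>t \<kappa> ^ a\<close> stay on the left so that no
  negative exponents arise.\<close>

lemma (in large_field) eigen_act_prod:
  fixes f :: "(nat \<times> nat \<Rightarrow> 'l) \<Rightarrow> 'l"
  assumes "finite K" "K \<subseteq> {..<n} \<times> {1..<d}" "\<And>\<kappa>. \<kappa> \<in> K \<Longrightarrow> eigen_along d n f \<kappa> (e \<kappa>)"
    and "\<And>\<kappa>. \<kappa> \<in> K \<Longrightarrow> t \<kappa> \<noteq> 0" and v: "v \<in> Xn d n"
  shows "act (\<lambda>x. \<Prod>\<kappa>\<in>K. one_param \<kappa> (t \<kappa>) x) v \<in> Xn d n \<and>
    (\<Prod>\<kappa>\<in>K. t \<kappa> ^ a) * f (act (\<lambda>x. \<Prod>\<kappa>\<in>K. one_param \<kappa> (t \<kappa>) x) v) = (\<Prod>\<kappa>\<in>K. t \<kappa> ^ e \<kappa>) * f v"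
  using assms(1-4)
proof (induction K rule: finite_induct)
  case empty
  then show ?case using v by (simp add: act_def)
next
  case (insert \<kappa> K)
  let ?w = "act (\<lambda>x. \<Prod>\<kappa>\<in>K. one_param \<kappa> (t \<kappa>) x) v"
  have IH: "?w \<in> Xn d n" "(\<Prod>\<kappa>\<in>K. t \<kappa> ^ a) * f ?w = (\<Prod>\<kappa>\<in>K. t \<kappa> ^ e \<kappa>) * f v"
    using insert by auto
  have eq: "act (\<lambda>x. \<Prod>\<kappa>\<in>insert \<kappa> K. one_param \<kappa> (t \<kappa>) x) v = act (one_param \<kappa> (t \<kappa>)) ?w"
    using insert.hyps by (simp add: act_def mult.assoc)
  obtain i j where \<kappa>: "\<kappa> = (i, j)" "i < n" "j < d" "0 < j" using insert.prems(1) by auto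
  have "act (one_param \<kappa> (t \<kappa>)) ?w \<in> Xn d n"
    by (rule Xn_act[OF IH(1)]) (use \<kappa> insert.prems(3)[of \<kappa>] in \<open>auto simp: one_param_row_prod\<close>)
  moreover have "t \<kappa> ^ a * f (act (one_param \<kappa> (t \<kappa>)) ?w) = t \<kappa> ^ e \<kappa> * f ?w"
    using insert.prems(2,3)[of \<kappa>] IH(1) unfolding eigen_along_def by blast
  then have "(\<Prod>\<kappa>\<in>K. t \<kappa> ^ a) * (t \<kappa> ^ a * f (act (one_param \<kappa> (t \<kappa>)) ?w))
      = t \<kappa> ^ e \<kappa> * ((\<Prod>\<kappa>\<in>K. t \<kappa> ^ a) * f ?w)"
    by (simp only: mult.left_commute)
  ultimately show ?case
    unfolding eq using insert.hyps IH(2) by (simp add: mult_ac)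
qed

text \<open>On \<open>coords d n\<close>, a torus element is the product of the one-parameter
  elements given by its entries outside column \<open>0\<close>. Exponents constant along each row
  contribute nothing, since row products are \<open>1\<close>; so both the shift by \<open>a\<close>
  and the row constants \<open>c i\<close> can be removed, which leaves
  \<open>\<theta>\<close>.\<close>

lemma (in large_field) eigen_act:
  fixes f :: "(nat \<times> nat \<Rightarrow> 'l) \<Rightarrow> 'l"
  assumes d: "d \<ge> 1" and e: "\<And>\<kappa>. \<kappa> \<in> {..<n} \<times> {1..<d} \<Longrightarrow> eigen_along d n f \<kappa> (e \<kappa>)"
    and e0: "\<And>i. e (i, 0) = a" and \<theta>: "\<And>i j. i < n \<Longrightarrow> j < d \<Longrightarrow> e (i, j) = \<theta> (i, j) + c i"
    and v: "v \<in> Xn d n" and t: "\<And>i. i < n \<Longrightarrow> (\<Prod>j<d. t (i, j)) = 1"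
  shows "f (act t v) = (\<Prod>x\<in>coords d n. t x ^ \<theta> x) * f v"
proof -
  let ?K = "{..<n} \<times> {1..<d}"
  have nz: "t (i, j) \<noteq> 0" if "i < n" "j < d" for i j
    using t[OF that(1)] that(2) prod_zero[of "{..<d}" "\<lambda>j. t (i, j)"] by force
  have split0: "(\<Prod>j<d. g j) = g 0 * (\<Prod>j\<in>{1..<d}. g j)" for g :: "nat \<Rightarrow> 'l"
  proof -
    have "(\<Prod>j<d. g j) = g 0 * (\<Prod>j\<in>{..<d} - {0}. g j)" using d by (intro prod.remove) auto
    also have "{..<d} - {0} = {1..<d}" by auto
    finally show ?thesis .
  qed
  have "act (\<lambda>x. \<Prod>\<kappa>\<in>?K. one_param \<kappa> (t \<kappa>) x) v = act t v"
  proof (rule act_cong_coords[OF v])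
    fix x assume "x \<in> coords d n"
    then obtain i j where x: "x = (i, j)" "i < n" "j < d" by (auto simp: coords_def)
    show "(\<Prod>\<kappa>\<in>?K. one_param \<kappa> (t \<kappa>) x) = t x"
    proof (cases "j = 0")
      case True
      have "(\<Prod>\<kappa>\<in>?K. one_param \<kappa> (t \<kappa>) x) = (\<Prod>i'<n. if i' = i then (\<Prod>j\<in>{1..<d}. 1 / t (i, j)) else 1)"
        unfolding prod.cartesian_product' using x True
        by (intro prod.cong refl) (auto simp: one_param_def intro!: prod.cong)
      also have "\<dots> = 1 / (\<Prod>j\<in>{1..<d}. t (i, j))" using x by (simp add: prod_dividef)
      also have "\<dots> = t (i, 0)"
      proof -
        have "(\<Prod>j\<in>{1..<d}. t (i, j)) \<noteq> 0" using nz[OF x(2)] by simp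
        then show ?thesis using t[OF x(2)] split0[of "\<lambda>j. t (i, j)"] by (simp add: divide_eq_eq del: prod_zero_iff)
      qed
      finally show ?thesis using x True by simp
    next
      case False
      have "(\<Prod>\<kappa>\<in>?K. one_param \<kappa> (t \<kappa>) x) = (\<Prod>\<kappa>\<in>?K. if \<kappa> = x then t x else 1)"
        using x False by (intro prod.cong refl) (auto simp: one_param_def)
      then show ?thesis using x False by simp
    qed
  qed
  then have main: "(\<Prod>\<kappa>\<in>?K. t \<kappa> ^ a) * f (act t v) = (\<Prod>\<kappa>\<in>?K. t \<kappa> ^ e \<kappa>) * f v"
    using eigen_act_prod[of ?K n d f e t v] e nz v by auto
  have sp: "(\<Prod>x\<in>coords d n. g x) = (\<Prod>i<n. g (i, 0)) * (\<Prod>\<kappa>\<in>?K. g \<kappa>)" for g :: "nat \<times> nat \<Rightarrow> 'l"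
    unfolding prod_coords prod.cartesian_product' split0 by (rule prod.distrib)
  have row_power: "(\<Prod>x\<in>coords d n. t x ^ k (fst x)) = 1" for k :: "nat \<Rightarrow> nat"
    unfolding prod_coords using t by (simp add: prod_power_distrib[symmetric])
  have "f (act t v) = (\<Prod>x\<in>coords d n. t x ^ a) * f (act t v)"
    using row_power[of "\<lambda>_. a"] by simp
  also have "\<dots> = (\<Prod>i<n. t (i, 0) ^ a) * ((\<Prod>\<kappa>\<in>?K. t \<kappa> ^ a) * f (act t v))"
    unfolding sp by (rule mult.assoc)
  also have "\<dots> = (\<Prod>i<n. t (i, 0) ^ e (i, 0)) * ((\<Prod>\<kappa>\<in>?K. t \<kappa> ^ e \<kappa>) * f v)"
    unfolding main e0 ..
  also have "\<dots> = (\<Prod>x\<in>coords d n. t x ^ e x) * f v"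
    unfolding sp by (rule mult.assoc[symmetric])
  also have "(\<Prod>x\<in>coords d n. t x ^ e x) = (\<Prod>x\<in>coords d n. t x ^ \<theta> x * t x ^ c (fst x))"
    by (intro prod.cong refl) (auto simp: coords_def \<theta> power_add)
  also have "\<dots> = (\<Prod>x\<in>coords d n. t x ^ \<theta> x)"
    unfolding prod.distrib row_power by simp
  finally show ?thesis .
qed

text \<open>The weights \<open>\<theta>\<close> are normalised to have minimum \<open>0\<close> in each row, attained at column \<open>b i\<close>.  They come from
  differences of modulus at most \<open>a\<close> to column \<open>0\<close>, so a priori they are only bounded by \<open>2 a\<close>, and
  exponents have to be compared in two steps through column \<open>0\<close>.\<close>

locale eigenfunction = large_field a C for a :: nat and C :: "'l::field set" +
  fixes d n :: nat and f :: "(nat \<times> nat \<Rightarrow> 'l) \<Rightarrow> 'l" and \<theta> :: "nat \<times> nat \<Rightarrow> nat" and b :: "nat \<Rightarrow> nat"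
  assumes weakly: "weakly_polynomial a (coords d n) (Xn d n) f"
    and base: "\<And>i. i < n \<Longrightarrow> b i < d" "\<And>i. i < n \<Longrightarrow> \<theta> (i, b i) = 0"
    and weight_0: "\<And>i. i < n \<Longrightarrow> \<theta> (i, 0) \<le> a"
    and weight_le: "\<And>i j. i < n \<Longrightarrow> j < d \<Longrightarrow> \<theta> (i, j) \<le> \<theta> (i, 0) + a"
    and eigen: "\<And>v t. v \<in> Xn d n \<Longrightarrow> (\<And>i. i < n \<Longrightarrow> (\<Prod>j<d. t (i, j)) = 1) \<Longrightarrow>
       f (act t v) = (\<Prod>x\<in>coords d n. t x ^ \<theta> x) * f v"
begin

section \<open>Eigenfunctions at points with vanishing coordinates\<close>

lemma d_pos: "i < n \<Longrightarrow> 0 < d"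
  using base(1) by fastforce

lemma cofactor_eq_0:
  fixes v :: "nat \<times> nat \<Rightarrow> 'l"
  shows "j' < d \<Longrightarrow> j' \<noteq> j \<Longrightarrow> v (i, j') = 0 \<Longrightarrow> row_cofactor d v i j = 0"
  by (rule prod_zero) auto

text \<open>Scaling \<open>(i, j)\<close> by \<open>u\<close> and \<open>(i, j')\<close> by
  \<open>1 / u\<close> moves only the first coordinate, because the second is zero. This gives the
  identity for nonzero \<open>y\<close>; both sides are polynomials in \<open>y\<close> of degree at
  most \<open>2 * a\<close>, so it persists at \<open>y = 0\<close>.\<close>

lemma scaling_on_zero:
  assumes v: "v \<in> Xn d n" "v (i, j') = 0" and i: "i < n" "j < d" "j' < d" "j \<noteq> j'"
    and \<theta>: "\<theta> (i, j) \<le> \<theta> (i, j')" "\<theta> (i, j') \<le> \<theta> (i, j) + a"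
  shows "y ^ (\<theta> (i, j') - \<theta> (i, j)) * f (v((i, j) := y)) = f (v((i, j) := 1))"
proof -
  let ?M = "\<theta> (i, j') - \<theta> (i, j)"
  have co: "row_cofactor d v i j = 0" using v i by (intro cofactor_eq_0) auto
  obtain q where q: "degree q \<le> a" "\<And>y. f (v((i, j) := y)) = poly q y"
    using weakly_polynomial_coordinate[OF weakly v(1) i(1,2) co] by metis
  have nonzero: "u ^ ?M * f (v((i, j) := u)) = f (v((i, j) := 1))" if u: "u \<noteq> 0" for u
  proof -
    define t where "t = (\<lambda>x. if x = (i, j) then u else if x = (i, j') then 1 / u else 1)"
    have "(\<Prod>k<d. t (i', k)) = 1" for i'
    proof (cases "i' = i")
      case True
      have "(\<Prod>k<d. t (i', k)) = (\<Prod>k\<in>{j, j'}. t (i', k))"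
        by (rule prod.mono_neutral_right) (use i True in \<open>auto simp: t_def\<close>)
      then show ?thesis using i True u by (simp add: t_def)
    qed (simp add: t_def)
    moreover have "v((i, j) := 1) \<in> Xn d n" using Xn_upd[OF v(1) i(1,2) co] .
    ultimately have "f (act t (v((i, j) := 1))) = (\<Prod>x\<in>coords d n. t x ^ \<theta> x) * f (v((i, j) := 1))"
      by (intro eigen)
    moreover have "act t (v((i, j) := 1)) = v((i, j) := u)"
      using v(2) i(4) by (auto simp: act_def t_def fun_eq_iff)
    moreover have "(\<Prod>x\<in>coords d n. t x ^ \<theta> x) = (\<Prod>x\<in>{(i, j), (i, j')}. t x ^ \<theta> x)"
      by (rule prod.mono_neutral_right) (use i in \<open>auto simp: t_def coords_def\<close>)
    ultimately have "f (v((i, j) := u)) = u ^ \<theta> (i, j) * (1 / u) ^ \<theta> (i, j') * f (v((i, j) := 1))"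
      using i(4) by (simp add: t_def)
    moreover have "u ^ ?M * (u ^ \<theta> (i, j) * (1 / u) ^ \<theta> (i, j')) = 1"
      using u \<theta>(1) by (simp add: mult.assoc[symmetric] power_add[symmetric] power_one_over)
    ultimately show ?thesis by (simp add: mult.assoc[symmetric])
  qed
  have "monom 1 ?M * q = [:poly q 1:]"
  proof (rule poly_eqI_nonzero)
    have "degree (monom 1 ?M * q) \<le> ?M + a"
      using degree_mult_le[of "monom 1 ?M" q] degree_monom_le[of "1::'l" ?M] q(1) by linarith
    then show "degree (monom 1 ?M * q) \<le> 2 * a" using \<theta>(2) by linarith
    show "poly (monom 1 ?M * q) u = poly [:poly q 1:] u" if "u \<noteq> 0" for u
      using nonzero[OF that] unfolding q(2) by (simp add: poly_monom)
  qed simp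
  then have "poly (monom 1 ?M * q) y = poly [:poly q 1:] y" by simp
  then show ?thesis unfolding q(2) by (simp add: poly_monom)
qed

text \<open>Against a column \<open>j\<close> of smaller weight, \<open>scaling_on_zero\<close> at
  \<open>y = 0\<close> shows that the value at \<open>y = 1\<close> is \<open>0\<close>; then
  \<open>f\<close> vanishes for every nonzero \<open>y\<close> and, being polynomial in
  \<open>y\<close>, for all \<open>y\<close>.\<close>

lemma vanishes_on_zero:
  assumes v: "v \<in> Xn d n" "v (i, j') = 0" and i: "i < n" "j' < d" and \<theta>: "\<theta> (i, j') > 0"
  shows "f v = 0"
proof -
  \<comment> \<open>Column \<open>b i\<close> has weight \<open>0\<close>, which may be more than
    \<open>a\<close> below; in that case column \<open>0\<close> is both smaller and within distance
    \<open>a\<close>.\<close>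
  obtain j where j: "j < d" "\<theta> (i, j) < \<theta> (i, j')" "\<theta> (i, j') \<le> \<theta> (i, j) + a"
  proof (cases "\<theta> (i, j') \<le> a")
    case True
    then show ?thesis using that[of "b i"] base[OF i(1)] \<theta> by simp
  next
    case False
    then show ?thesis using that[of 0] weight_0[OF i(1)] weight_le[OF i] d_pos[OF i(1)] by simp
  qed
  then have jj: "j \<noteq> j'" by auto
  have *: "y ^ (\<theta> (i, j') - \<theta> (i, j)) * f (v((i, j) := y)) = f (v((i, j) := 1))" for y
    using j jj i v by (intro scaling_on_zero) auto
  have "f (v((i, j) := 1)) = 0" using *[of 0] j(2) by (simp add: power_0_left)
  then have nz: "f (v((i, j) := y)) = 0" if "y \<noteq> 0" for y using *[of y] that by simp
  have "row_cofactor d v i j = 0" using v i jj by (intro cofactor_eq_0) auto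
  then obtain q where q: "degree q \<le> a" "\<And>y. f (v((i, j) := y)) = poly q y"
    using weakly_polynomial_coordinate[OF weakly v(1) i(1) j(1)] by metis
  have "q = 0" by (rule poly_eqI_nonzero) (use q nz in auto)
  then have "f (v((i, j) := v (i, j))) = 0" unfolding q(2) by simp
  then show ?thesis by simp
qed

lemma constant_on_zero:
  assumes "v \<in> Xn d n" "v (i, j') = 0" "i < n" "j < d" "j' < d" "j \<noteq> j'" "\<theta> (i, j) = \<theta> (i, j')"
  shows "f (v((i, j) := y)) = f v"
proof -
  have "f (v((i, j) := y)) = f (v((i, j) := 1))" for y
    using scaling_on_zero[of v i j' j y] assms by simp
  from this[of y] this[of "v (i, j)"] show ?thesis by simp
qed

text \<open>A section of the map that sends a point to its row products: the product
  \<open>c i\<close> of row \<open>i\<close> is carried by the base column.\<close>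

definition section_point :: "(nat \<Rightarrow> 'l) \<Rightarrow> nat \<times> nat \<Rightarrow> 'l" where
  "section_point c = (\<lambda>x. if x \<in> coords d n then if snd x = b (fst x) then c (fst x) else 1 else 0)"

lemma section_point_row_prod:
  assumes "i < n"
  shows "(\<Prod>j<d. section_point c (i, j) ^ k j) = c i ^ k (b i)"
proof -
  have "(\<Prod>j<d. section_point c (i, j) ^ k j) = (\<Prod>j<d. if j = b i then c i ^ k (b i) else 1)"
    using assms by (intro prod.cong) (auto simp: section_point_def coords_def)
  then show ?thesis using base(1)[OF assms] by simp
qed

lemma section_point_in_Xn: "(\<Sum>i<n. c i) = 0 \<Longrightarrow> section_point c \<in> Xn d n"
  using section_point_row_prod[of _ c "\<lambda>_. 1"]
  by (auto simp: Xn_def affine_points_def section_point_def)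

text \<open>If all coordinates off the base columns are nonzero, a torus element carries the section
  point to \<open>v\<close>. Otherwise take a zero off the base: with positive weight both sides
  vanish, and with weight \<open>0\<close> it can be traded for a zero at the base without changing
  either side, which lowers the number of such zeros.\<close>

lemma eq_on_section:
  assumes "v \<in> Xn d n"
  shows "f v = (\<Prod>x\<in>coords d n. v x ^ \<theta> x) * f (section_point (\<lambda>i. \<Prod>j<d. v (i, j)))"
  using assms
proof (induction "card {x \<in> coords d n. snd x \<noteq> b (fst x) \<and> v x = 0}" arbitrary: v rule: less_induct)
  case less
  let ?Z = "\<lambda>v. {x \<in> coords d n. snd x \<noteq> b (fst x) \<and> v x = (0::'l)}"
  show ?case
  proof (cases "?Z v = {}")
    case True
    then have nz: "v (i, j) \<noteq> 0" if "i < n" "j < d" "j \<noteq> b i" for i j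
      using that by (auto simp: coords_def)
    define t where "t = (\<lambda>x. if snd x = b (fst x) then 1 / row_cofactor d v (fst x) (b (fst x)) else v x)"
    have cof: "row_cofactor d v i (b i) \<noteq> 0" if "i < n" for i
      using nz[OF that] by auto
    have "(\<Prod>j<d. t (i, j)) = 1" if i: "i < n" for i
    proof -
      have "(\<Prod>j\<in>{..<d} - {b i}. t (i, j)) = row_cofactor d v i (b i)"
        by (intro prod.cong) (auto simp: t_def)
      then show ?thesis
        using row_prod_remove[OF base(1)[OF i], of t i] cof[OF i] by (simp add: t_def del: prod_zero_iff)
    qed
    moreover have "section_point (\<lambda>i. \<Prod>j<d. v (i, j)) \<in> Xn d n"
      using less.prems by (intro section_point_in_Xn) (simp add: Xn_def)
    ultimately have "f (act t (section_point (\<lambda>i. \<Prod>j<d. v (i, j)))) =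
        (\<Prod>x\<in>coords d n. t x ^ \<theta> x) * f (section_point (\<lambda>i. \<Prod>j<d. v (i, j)))"
      by (intro eigen)
    moreover have "act t (section_point (\<lambda>i. \<Prod>j<d. v (i, j))) = v"
    proof
      fix x
      show "act t (section_point (\<lambda>i. \<Prod>j<d. v (i, j))) x = v x"
      proof (cases "x \<in> coords d n")
        case True
        then obtain i j where x: "x = (i, j)" "i < n" "j < d" by (auto simp: coords_def)
        then show ?thesis
          using True cof[OF x(2)] row_prod_remove[OF base(1)[OF x(2)], of v i]
          by (auto simp: act_def t_def section_point_def simp del: prod_zero_iff)
      next
        case False
        then show ?thesis using less.prems
          by (cases x) (auto simp: act_def section_point_def Xn_def affine_points_def)
      qed
    qed
    moreover have "(\<Prod>x\<in>coords d n. t x ^ \<theta> x) = (\<Prod>x\<in>coords d n. v x ^ \<theta> x)"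
      by (intro prod.cong refl) (auto simp: t_def coords_def base(2))
    ultimately show ?thesis by simp
  next
    case False
    then obtain i j' where ij: "i < n" "j' < d" "j' \<noteq> b i" "v (i, j') = 0" by (auto simp: coords_def)
    show ?thesis
    proof (cases "\<theta> (i, j') = 0")
      case False
      then have "(\<Prod>x\<in>coords d n. v x ^ \<theta> x) = 0"
        using ij by (intro prod_zero bexI[of _ "(i, j')"]) (auto simp: coords_def)
      moreover have "f v = 0" using ij False less.prems by (intro vanishes_on_zero) auto
      ultimately show ?thesis by simp
    next
      case True
      note bi = base[OF ij(1)]
      \<comment> \<open>The zero at \<open>(i, j')\<close> permits changing the base coordinate to
        \<open>0\<close>; this zero then permits changing \<open>(i, j')\<close> to
        \<open>1\<close>. Both weights are \<open>0\<close>, so \<open>f\<close> is constant along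
        both moves.\<close>
      define w' where "w' = v((i, b i) := 0)"
      define w where "w = w'((i, j') := 1)"
      have w': "w' \<in> Xn d n" unfolding w'_def
        using ij bi less.prems by (intro Xn_upd cofactor_eq_0[of j']) auto
      have w: "w \<in> Xn d n" unfolding w_def
        using ij bi w' by (intro Xn_upd cofactor_eq_0[of "b i"]) (auto simp: w'_def)
      have "f w' = f v" unfolding w'_def
        using ij bi less.prems True by (intro constant_on_zero[of v i j']) auto
      moreover have "f w = f w'" unfolding w_def
        using ij bi w' True by (intro constant_on_zero[of w' i "b i"]) (auto simp: w'_def)
      moreover have "f w = (\<Prod>x\<in>coords d n. w x ^ \<theta> x) * f (section_point (\<lambda>i. \<Prod>j<d. w (i, j)))"
      proof (rule less.hyps[OF psubset_card_mono w])
        have "(i, j') \<in> ?Z v - ?Z w" using ij by (auto simp: coords_def w_def)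
        moreover have "?Z w \<subseteq> ?Z v" by (auto simp: w_def w'_def split: if_splits)
        ultimately show "?Z w \<subset> ?Z v" by blast
      qed simp
      moreover have "(\<Prod>x\<in>coords d n. w x ^ \<theta> x) = (\<Prod>x\<in>coords d n. v x ^ \<theta> x)"
        using bi True by (intro prod.cong refl) (auto simp: w_def w'_def)
      moreover have "(\<Prod>j<d. w (i', j)) = (\<Prod>j<d. v (i', j))" for i'
      proof (cases "i' = i")
        case True
        have "(\<Prod>j<d. w (i, j)) = 0"
          by (rule prod_zero) (use bi ij in \<open>auto simp: w_def w'_def intro!: bexI[of _ "b i"]\<close>)
        moreover have "(\<Prod>j<d. v (i, j)) = 0"
          by (rule prod_zero) (use ij in \<open>auto intro!: bexI[of _ j']\<close>)
        ultimately show ?thesis using True by (simp only:)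
      next
        case False
        then show ?thesis by (intro prod.cong) (auto simp: w_def w'_def)
      qed
      ultimately show ?thesis by simp
    qed
  qed
qed

section \<open>Restriction of an eigenfunction to the section\<close>

definition base_deg :: "(nat \<times> nat \<Rightarrow>\<^sub>0 nat) \<Rightarrow> nat" where
  "base_deg m = (\<Sum>i<n. Poly_Mapping.lookup m (i, b i))"

lemma base_deg_le:
  assumes "Poly_Mapping.keys m \<subseteq> coords d n"
  shows "base_deg m \<le> monom_deg m"
proof -
  have "base_deg m \<le> (\<Sum>i<n. \<Sum>j<d. Poly_Mapping.lookup m (i, j))"
    unfolding base_deg_def using base(1) by (intro sum_mono member_le_sum) auto
  then show ?thesis using monom_deg_superset[OF _ assms] by (simp add: sum_coords)
qed

lemma base_deg_le_total:
  assumes "mvars p \<subseteq> coords d n" "total_degree p \<le> a" "m \<in> Poly_Mapping.keys p"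
  shows "base_deg m \<le> a"
proof -
  have "base_deg m \<le> monom_deg m" using assms by (intro base_deg_le) (auto simp: mvars_subset_iff)
  also have "\<dots> \<le> a" using assms by (auto simp: total_degree_le_iff)
  finally show ?thesis .
qed

text \<open>The homogeneous component of degree \<open>k\<close> in \<open>c\<close> of the
  restriction of \<open>p\<close> to the section, taken as a function of \<open>c\<close> because
  different polynomials may agree on the hyperplane where the \<open>c i\<close> sum to
  zero.\<close>

definition section_part :: "(nat \<times> nat, 'l) mpoly \<Rightarrow> nat \<Rightarrow> (nat \<Rightarrow> 'l) \<Rightarrow> 'l" where
  "section_part p k c = (\<Sum>m\<in>{m \<in> Poly_Mapping.keys p. base_deg m = k}.
     Poly_Mapping.lookup p m * (\<Prod>i<n. c i ^ Poly_Mapping.lookup m (i, b i)))"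

lemma section_part_scale: "section_part p k (\<lambda>i. s * c i) = s ^ k * section_part p k c"
  unfolding section_part_def sum_distrib_left
  by (intro sum.cong refl)
     (auto simp: power_mult_distrib prod.distrib power_sum[symmetric] base_deg_def)

lemma mpoly_eval_section:
  assumes "mvars p \<subseteq> coords d n" "total_degree p \<le> a"
  shows "mpoly_eval (section_point c) p = (\<Sum>k\<le>a. section_part p k c)"
proof -
  have "mpoly_eval (section_point c) p = (\<Sum>m\<in>Poly_Mapping.keys p. Poly_Mapping.lookup p m *
      (\<Prod>i<n. c i ^ Poly_Mapping.lookup m (i, b i)))"
    unfolding mpoly_eval_def
  proof (intro sum.cong refl arg_cong2[of _ _ _ _ "(*)"])
    fix m assume "m \<in> Poly_Mapping.keys p"
    then have "Poly_Mapping.keys m \<subseteq> coords d n" using assms(1) by (auto simp: mvars_subset_iff)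
    then have "(\<Prod>x\<in>Poly_Mapping.keys m. section_point c x ^ Poly_Mapping.lookup m x)
        = (\<Prod>x\<in>coords d n. section_point c x ^ Poly_Mapping.lookup m x)"
      by (intro monom_eval_superset) auto
    then show "(\<Prod>x\<in>Poly_Mapping.keys m. section_point c x ^ Poly_Mapping.lookup m x)
        = (\<Prod>i<n. c i ^ Poly_Mapping.lookup m (i, b i))"
      by (simp add: prod_coords section_point_row_prod)
  qed
  also have "\<dots> = (\<Sum>k\<le>a. section_part p k c)"
    unfolding section_part_def
  proof (rule sum.group[symmetric])
    show "base_deg ` Poly_Mapping.keys p \<subseteq> {..a}"
      using base_deg_le_total[OF assms] by auto
  qed auto
  finally show ?thesis .
qed

text \<open>The section is affine-linear in \<open>c\<close>, so its points with
  \<open>(\<Sum>i<n. c i) = 0\<close> form an affine subspace of the hypersurface, and weak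
  polynomiality supplies \<open>p\<close>.\<close>

lemma section_polynomial:
  obtains p where "mvars p \<subseteq> coords d n" "total_degree p \<le> a"
    "\<And>c. (\<Sum>i<n. c i) = 0 \<Longrightarrow> f (section_point c) = (\<Sum>k\<le>a. section_part p k c)"
proof -
  define dir where "dir c = (\<lambda>x. if x \<in> coords d n \<and> snd x = b (fst x) then c (fst x) else (0::'l))" for c
  define U where "U = dir ` {c. (\<Sum>i<n. c i) = 0}"
  have "fun_vs.subspace U"
    unfolding fun_vs.subspace_def
  proof (intro conjI ballI allI)
    have "0 = dir 0" by (auto simp: dir_def fun_eq_iff)
    then show "0 \<in> U" unfolding U_def by (intro image_eqI[of _ _ 0]) auto
  next
    fix y z assume "y \<in> U" "z \<in> U"
    then obtain c c' where c: "y = dir c" "z = dir c'" "(\<Sum>i<n. c i) = 0" "(\<Sum>i<n. c' i) = 0"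
      by (auto simp: U_def)
    have "y + z = dir (\<lambda>i. c i + c' i)" by (auto simp: c dir_def fun_eq_iff)
    moreover have "(\<Sum>i<n. c i + c' i) = 0" using c by (simp add: sum.distrib)
    ultimately show "y + z \<in> U" unfolding U_def by blast
  next
    fix s y assume "y \<in> U"
    then obtain c where c: "y = dir c" "(\<Sum>i<n. c i) = 0" by (auto simp: U_def)
    have "(\<lambda>x. s * y x) = dir (\<lambda>i. s * c i)" by (auto simp: c dir_def fun_eq_iff)
    moreover have "(\<Sum>i<n. s * c i) = 0" using c by (simp add: sum_distrib_left[symmetric])
    ultimately show "(\<lambda>x. s * y x) \<in> U" unfolding U_def by blast
  qed
  then have "is_affine_subspace ((\<lambda>u. section_point (\<lambda>_. 0) + u) ` U)"
    unfolding is_affine_subspace_def by blast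
  moreover have pt: "section_point (\<lambda>_. 0) + dir c = section_point c" for c
    by (auto simp: section_point_def dir_def fun_eq_iff)
  then have L: "(\<lambda>u. section_point (\<lambda>_. 0) + u) ` U = section_point ` {c. (\<Sum>i<n. c i) = 0}"
    by (simp add: U_def image_image)
  then have "(\<lambda>u. section_point (\<lambda>_. 0) + u) ` U \<subseteq> Xn d n"
    using section_point_in_Xn by auto
  ultimately have "polynomial_on a (coords d n) (section_point ` {c. (\<Sum>i<n. c i) = 0}) f"
    using weakly unfolding weakly_polynomial_def L by blast
  then show ?thesis using that mpoly_eval_section unfolding polynomial_on_def by auto
qed

text \<open>Scaling the coordinates in \<open>S\<close> by \<open>s\<close> moves a point of the section along a line in the hypersurface, on
  which \<open>f\<close> is a polynomial in \<open>s\<close> of degree at most \<open>a\<close>.  An a priori bound of \<open>2 a\<close> on the exponents suffices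
  to read off that they are at most \<open>a\<close>.\<close>

lemma degree_bound_along_scaling:
  assumes p: "\<And>c. (\<Sum>i<n. c i) = 0 \<Longrightarrow> f (section_point c) = (\<Sum>k\<le>a. section_part p k c)"
    and c: "(\<Sum>i<n. c i) = 0"
    and S: "S \<subseteq> coords d n" "\<And>i. i < n \<Longrightarrow> card {j \<in> {..<d}. (i, j) \<in> S} = r" and r: "r \<ge> 1"
    and le: "\<And>k. k \<le> a \<Longrightarrow> section_part p k c \<noteq> 0 \<Longrightarrow> (\<Sum>x\<in>S. \<theta> x) + r * k \<le> 2 * a"
    and k: "k \<le> a" "section_part p k c \<noteq> 0"
  shows "(\<Sum>x\<in>S. \<theta> x) + r * k \<le> a"
proof -
  define E where "E = (\<Sum>x\<in>S. \<theta> x)"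
  define pt where "pt s = (\<lambda>x. (if x \<in> S then s else 1) * section_point c x)" for s
  have row: "(\<Prod>j<d. pt s (i, j)) = s ^ r * c i" if i: "i < n" for i s
  proof -
    have "(\<Prod>j<d. if (i, j) \<in> S then s else 1) = (\<Prod>j\<in>{j \<in> {..<d}. (i, j) \<in> S}. s)"
      by (rule prod.inter_filter[symmetric]) simp
    also have "\<dots> = s ^ r" using S(2)[OF i] by simp
    finally show ?thesis
      using section_point_row_prod[OF i, of c "\<lambda>_. 1"] by (simp add: pt_def prod.distrib)
  qed
  have X: "pt s \<in> Xn d n" for s
  proof -
    have "(\<Sum>i<n. \<Prod>j<d. pt s (i, j)) = 0" using c by (simp add: row sum_distrib_left[symmetric])
    then show ?thesis by (auto simp: Xn_def affine_points_def pt_def section_point_def)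
  qed
  have line: "(\<lambda>x. (if x \<in> S then 0 else section_point c x) + s * (if x \<in> S then section_point c x else 0)) = pt s" for s
    by (auto simp: pt_def fun_eq_iff)
  obtain q where q: "degree q \<le> a" "\<And>s. f (pt s) = poly q s"
    using weakly_polynomial_line[OF weakly, of "\<lambda>x. if x \<in> S then 0 else section_point c x"
        "\<lambda>x. if x \<in> S then section_point c x else 0"] X unfolding line by metis
  have fpt: "f (pt s) = (\<Sum>k\<le>a. section_part p k c * s ^ (E + r * k))" for s
  proof -
    have "(\<Prod>x\<in>coords d n. pt s x ^ \<theta> x) = (\<Prod>x\<in>coords d n. if x \<in> S then s ^ \<theta> x else 1)"
      by (intro prod.cong refl) (auto simp: pt_def section_point_def coords_def base(2))
    also have "\<dots> = (\<Prod>x\<in>coords d n \<inter> S. s ^ \<theta> x)"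
      by (rule prod.inter_restrict[symmetric]) simp
    also have "\<dots> = s ^ E" using S(1) by (simp add: E_def power_sum Int_absorb1)
    finally have 1: "(\<Prod>x\<in>coords d n. pt s x ^ \<theta> x) = s ^ E" .
    have 2: "section_point (\<lambda>i. \<Prod>j<d. pt s (i, j)) = section_point (\<lambda>i. s ^ r * c i)"
      by (auto simp: section_point_def fun_eq_iff coords_def row)
    have "f (section_point (\<lambda>i. s ^ r * c i)) = (\<Sum>k\<le>a. section_part p k (\<lambda>i. s ^ r * c i))"
      using c by (intro p) (simp add: sum_distrib_left[symmetric])
    then show ?thesis
      unfolding eq_on_section[OF X] 1 2 power_add power_mult section_part_scale
      by (simp only: sum_distrib_left mult_ac)
  qed
  define Q where "Q = (\<Sum>k\<le>a. monom (section_part p k c) (E + r * k))"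
  have "Q = q"
  proof (rule poly_eqI_nonzero)
    show "degree Q \<le> 2 * a" unfolding Q_def
    proof (rule degree_sum_le)
      fix k assume "k \<in> {..a}"
      then show "degree (monom (section_part p k c) (E + r * k)) \<le> 2 * a"
        using le[of k] unfolding E_def
        by (cases "section_part p k c = 0") (auto simp: degree_monom_eq)
    qed simp
    show "poly Q u = poly q u" for u
      unfolding q(2)[symmetric] fpt by (simp add: Q_def poly_sum poly_monom)
  qed (use q in simp)
  \<comment> \<open>As \<open>r \<ge> 1\<close>, different \<open>k\<close> give different
    exponents, so the terms of \<open>Q\<close> cannot cancel.\<close>
  moreover have "coeff Q (E + r * k) = section_part p k c"
  proof -
    have "coeff Q (E + r * k) = (\<Sum>k'\<le>a. if k' = k then section_part p k c else 0)"
      unfolding Q_def coeff_sum using r by (intro sum.cong refl) auto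
    then show ?thesis using k by simp
  qed
  ultimately have "coeff q (E + r * k) \<noteq> 0" using k by simp
  then have "E + r * k \<le> degree q" by (rule le_degree)
  then show ?thesis using q(1) by (simp add: E_def)
qed

text \<open>The transversal is changed one row at a time, starting from \<open>b\<close>, where the
  weights sum to \<open>0\<close>. Each change passes through column \<open>0\<close>, since neither
  \<open>\<theta> (r, 0)\<close> nor the further increase to the target column exceeds
  \<open>a\<close>; so the bound is at most \<open>2 * a\<close> after each move, and
  \<open>step\<close> improves it to \<open>a\<close>.\<close>

lemma degree_bound_transversal:
  assumes p: "\<And>c. (\<Sum>i<n. c i) = 0 \<Longrightarrow> f (section_point c) = (\<Sum>k\<le>a. section_part p k c)"
    and c: "(\<Sum>i<n. c i) = 0"
    and t: "\<And>i. i < n \<Longrightarrow> t i < d"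
    and k: "k \<le> a" "section_part p k c \<noteq> 0"
  shows "(\<Sum>i<n. \<theta> (i, t i)) + k \<le> a"
proof -
  have step: "(\<Sum>i<n. \<theta> (i, t i)) + k \<le> a"
    if t: "\<And>i. i < n \<Longrightarrow> t i < d" and k: "k \<le> a" "section_part p k c \<noteq> 0"
      and le: "\<And>k. k \<le> a \<Longrightarrow> section_part p k c \<noteq> 0 \<Longrightarrow> (\<Sum>i<n. \<theta> (i, t i)) + k \<le> 2 * a" for t k
  proof -
    let ?S = "(\<lambda>i. (i, t i)) ` {..<n}"
    have s: "(\<Sum>x\<in>?S. \<theta> x) = (\<Sum>i<n. \<theta> (i, t i))"
      by (subst sum.reindex) (auto simp: inj_on_def)
    have "{j \<in> {..<d}. (i, j) \<in> ?S} = {t i}" if "i < n" for i using t that by auto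
    then have "(\<Sum>x\<in>?S. \<theta> x) + 1 * k \<le> a"
      using t k le by (intro degree_bound_along_scaling[OF p c]) (auto simp: coords_def s)
    then show ?thesis by (simp add: s)
  qed
  have upd: "(\<Sum>i<n. \<theta> (i, (t(r := j)) i)) = \<theta> (r, j) + (\<Sum>i\<in>{..<n} - {r}. \<theta> (i, t i))"
    if "r < n" for t r j
    using that by (subst sum.remove[of _ r]) (auto intro!: sum.cong)
  have "(\<forall>k\<le>a. section_part p k c \<noteq> 0 \<longrightarrow> (\<Sum>i<n. \<theta> (i, t i)) + k \<le> a)"
    if "r \<le> n" "\<And>i. i < n \<Longrightarrow> t i < d" "\<And>i. r \<le> i \<Longrightarrow> i < n \<Longrightarrow> t i = b i" for r t
    using that
  proof (induction r arbitrary: t)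
    case 0
    then show ?case by (simp add: base(2))
  next
    case (Suc r)
    then have r: "r < n" by simp
    define E where "E = (\<Sum>i\<in>{..<n} - {r}. \<theta> (i, t i))"
    have IH: "E + k \<le> a" if "k \<le> a" "section_part p k c \<noteq> 0" for k
    proof -
      have "(\<Sum>i<n. \<theta> (i, (t(r := b r)) i)) + k \<le> a"
        using Suc.IH[of "t(r := b r)"] Suc.prems base(1) that by (auto simp: not_less_eq_eq le_Suc_eq)
      then show ?thesis unfolding upd[OF r] E_def base(2)[OF r] by simp
    qed
    have zero: "\<theta> (r, 0) + E + k \<le> a" if "k \<le> a" "section_part p k c \<noteq> 0" for k
    proof -
      have "(\<Sum>i<n. \<theta> (i, (t(r := 0)) i)) + k \<le> a"
      proof (rule step[OF _ that])
        show "(t(r := 0)) i < d" if "i < n" for i using that Suc.prems(2) d_pos by simp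
        show "(\<Sum>i<n. \<theta> (i, (t(r := 0)) i)) + k \<le> 2 * a" if "k \<le> a" "section_part p k c \<noteq> 0" for k
          using IH[OF that] weight_0[OF r] unfolding upd[OF r] E_def by simp
      qed
      then show ?thesis unfolding upd[OF r] E_def .
    qed
    have tE: "(\<Sum>i<n. \<theta> (i, t i)) = \<theta> (r, t r) + E"
      using upd[OF r, of t "t r"] by (simp add: E_def)
    show ?case
    proof (intro allI impI)
      fix k assume k: "k \<le> a" "section_part p k c \<noteq> 0"
      show "(\<Sum>i<n. \<theta> (i, t i)) + k \<le> a"
      proof (rule step[OF Suc.prems(2) k])
        show "(\<Sum>i<n. \<theta> (i, t i)) + k \<le> 2 * a" if "k \<le> a" "section_part p k c \<noteq> 0" for k
          using zero[OF that] weight_le[OF r Suc.prems(2)[OF r]] unfolding tE by simp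
      qed
    qed
  qed
  from this[of n t] show ?thesis using t k by auto
qed

text \<open>Columns are adjoined one at a time. The first \<open>r\<close> columns and the new one,
  a constant transversal, satisfy the bound \<open>a\<close> separately, hence \<open>2 * a\<close>
  together, which scaling all of them at once improves to \<open>a\<close>.\<close>

lemma degree_bound:
  assumes p: "\<And>c. (\<Sum>i<n. c i) = 0 \<Longrightarrow> f (section_point c) = (\<Sum>k\<le>a. section_part p k c)"
    and c: "(\<Sum>i<n. c i) = 0" and d: "d \<ge> 1"
    and k: "k \<le> a" "section_part p k c \<noteq> 0"
  shows "(\<Sum>x\<in>coords d n. \<theta> x) + d * k \<le> a"
proof -
  have col: "(\<Sum>i<n. \<theta> (i, r)) + k \<le> a" if "r < d" "k \<le> a" "section_part p k c \<noteq> 0" for r k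
    using degree_bound_transversal[OF p c, of "\<lambda>_. r" k] that by simp
  have sumS: "(\<Sum>x\<in>{..<n} \<times> {..<Suc r}. \<theta> x) = (\<Sum>x\<in>{..<n} \<times> {..<r}. \<theta> x) + (\<Sum>i<n. \<theta> (i, r))" for r
    by (simp add: sum.cartesian_product' sum.distrib)
  have "r \<le> d \<longrightarrow> (\<forall>k\<le>a. section_part p k c \<noteq> 0 \<longrightarrow> (\<Sum>x\<in>{..<n} \<times> {..<r}. \<theta> x) + r * k \<le> a)"
    if "1 \<le> r" for r
    using that
  proof (induction r rule: nat_induct_at_least)
    case base
    show ?case using col[of 0] d by (auto simp: sum.cartesian_product')
  next
    case (Suc r)
    show ?case
    proof (intro impI allI)
      fix k assume r: "Suc r \<le> d" and k: "k \<le> a" "section_part p k c \<noteq> 0"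
      show "(\<Sum>x\<in>{..<n} \<times> {..<Suc r}. \<theta> x) + Suc r * k \<le> a"
      proof (rule degree_bound_along_scaling[OF p c])
        show "card {j \<in> {..<d}. (i, j) \<in> {..<n} \<times> {..<Suc r}} = Suc r" if "i < n" for i
        proof -
          have "{j \<in> {..<d}. (i, j) \<in> {..<n} \<times> {..<Suc r}} = {..<Suc r}" using that r by auto
          then show ?thesis by simp
        qed
        show "(\<Sum>x\<in>{..<n} \<times> {..<Suc r}. \<theta> x) + Suc r * k \<le> 2 * a"
          if "k \<le> a" "section_part p k c \<noteq> 0" for k
          using Suc.IH r that col[of r k] unfolding sumS by fastforce
      qed (use r k in \<open>auto simp: coords_def\<close>)
    qed
  qed
  from this[of d] show ?thesis using d k by (simp add: coords_def)
qed

text \<open>Substituting row products for \<open>c\<close> and multiplying by the weight monomial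
  turns \<open>m\<close> into \<open>ex m\<close>, of degree \<open>W + d * base_deg m\<close>.
  Terms above degree \<open>a\<close> are dropped: their coefficients need not vanish, but by
  \<open>degree_bound\<close> the whole component is zero on the hyperplane.\<close>

lemma extends_eigenfunction:
  assumes d: "d \<ge> 1"
  shows "extends d n f"
proof -
  obtain p where p: "mvars p \<subseteq> coords d n" "total_degree p \<le> a"
    "\<And>c. (\<Sum>i<n. c i) = 0 \<Longrightarrow> f (section_point c) = (\<Sum>k\<le>a. section_part p k c)"
    by (rule section_polynomial) blast
  define W where "W = (\<Sum>x\<in>coords d n. \<theta> x)"
  define ex where "ex m = (\<Sum>x\<in>coords d n. Poly_Mapping.single x (\<theta> x + Poly_Mapping.lookup m (fst x, b (fst x))))"
    for m :: "nat \<times> nat \<Rightarrow>\<^sub>0 nat"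
  define M where "M = {m \<in> Poly_Mapping.keys p. W + d * base_deg m \<le> a}"
  define g where "g = (\<Sum>m\<in>M. Poly_Mapping.single (ex m) (Poly_Mapping.lookup p m))"
  have finM: "finite M" by (simp add: M_def)
  have keys_ex: "Poly_Mapping.keys (ex m) \<subseteq> coords d n" for m
    unfolding ex_def by (rule order_trans[OF keys_sum_subset]) auto
  have deg_ex: "monom_deg (ex m) = W + d * base_deg m" for m
    unfolding ex_def W_def base_deg_def monom_deg_sum
    by (simp add: sum.distrib sum_coords sum_distrib_left)
  have lookup_ex: "Poly_Mapping.lookup (ex m) x = \<theta> x + Poly_Mapping.lookup m (fst x, b (fst x))"
    if "x \<in> coords d n" for m x
    unfolding ex_def lookup_sum using that by (simp add: lookup_single when_def)
  have kg: "Poly_Mapping.keys g \<subseteq> ex ` M"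
    unfolding g_def by (rule order_trans[OF keys_sum_subset]) auto
  have "mvars g \<subseteq> coords d n"
    unfolding mvars_subset_iff using kg keys_ex by blast
  moreover have "total_degree g \<le> a"
    unfolding total_degree_le_iff using kg by (auto simp: deg_ex M_def)
  moreover have "f v = mpoly_eval v g" if v: "v \<in> Xn d n" for v
  proof -
    define c where "c = (\<lambda>i. \<Prod>j<d. v (i, j))"
    have c: "(\<Sum>i<n. c i) = 0" using v by (simp add: Xn_def c_def)
    have mono: "(\<Prod>x\<in>Poly_Mapping.keys (ex m). v x ^ Poly_Mapping.lookup (ex m) x)
        = (\<Prod>x\<in>coords d n. v x ^ \<theta> x) * (\<Prod>i<n. c i ^ Poly_Mapping.lookup m (i, b i))" for m
    proof -
      have "(\<Prod>x\<in>Poly_Mapping.keys (ex m). v x ^ Poly_Mapping.lookup (ex m) x)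
          = (\<Prod>x\<in>coords d n. v x ^ \<theta> x * v x ^ Poly_Mapping.lookup m (fst x, b (fst x)))"
        unfolding monom_eval_superset[OF finite_coords keys_ex]
        by (intro prod.cong refl) (simp add: lookup_ex power_add)
      also have "\<dots> = (\<Prod>x\<in>coords d n. v x ^ \<theta> x) *
          (\<Prod>x\<in>coords d n. v x ^ Poly_Mapping.lookup m (fst x, b (fst x)))"
        by (rule prod.distrib)
      also have "(\<Prod>x\<in>coords d n. v x ^ Poly_Mapping.lookup m (fst x, b (fst x)))
          = (\<Prod>i<n. c i ^ Poly_Mapping.lookup m (i, b i))"
        unfolding prod_coords c_def by (simp add: prod_power_distrib)
      finally show ?thesis .
    qed
    have "(\<Sum>k\<le>a. section_part p k c) = (\<Sum>k\<in>{k \<in> {..a}. W + d * k \<le> a}. section_part p k c)"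
      using degree_bound[OF p(3) c d] unfolding W_def
      by (intro sum.mono_neutral_right) auto
    also have "\<dots> = (\<Sum>k\<in>{k \<in> {..a}. W + d * k \<le> a}. \<Sum>m\<in>{m \<in> M. base_deg m = k}.
        Poly_Mapping.lookup p m * (\<Prod>i<n. c i ^ Poly_Mapping.lookup m (i, b i)))"
      unfolding section_part_def by (intro sum.cong refl) (auto simp: M_def)
    also have "\<dots> = (\<Sum>m\<in>M. Poly_Mapping.lookup p m * (\<Prod>i<n. c i ^ Poly_Mapping.lookup m (i, b i)))"
    proof (rule sum.group[OF finM])
      show "base_deg ` M \<subseteq> {k \<in> {..a}. W + d * k \<le> a}"
        using base_deg_le_total[OF p(1,2)] unfolding M_def by auto
    qed simp
    finally have "f v = (\<Prod>x\<in>coords d n. v x ^ \<theta> x) *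
        (\<Sum>m\<in>M. Poly_Mapping.lookup p m * (\<Prod>i<n. c i ^ Poly_Mapping.lookup m (i, b i)))"
      using eq_on_section[OF v] p(3)[OF c] by (simp add: c_def)
    also have "\<dots> = mpoly_eval v g"
      unfolding g_def mpoly_eval_sum mpoly_eval_single mono sum_distrib_left
      by (intro sum.cong refl) (simp add: mult_ac)
    finally show ?thesis .
  qed
  ultimately show ?thesis
    unfolding extends_def polynomial_on_def by (intro exI[of _ "\<lambda>v. mpoly_eval v g"]) auto
qed

end

lemma (in large_field) weakly_polynomial_extends:
  fixes f :: "(nat \<times> nat \<Rightarrow> 'l) \<Rightarrow> 'l"
  assumes d: "d \<ge> 1" and f: "weakly_polynomial a (coords d n) (Xn d n) f"
  shows "extends d n f"
  using f
proof (rule extends_if_eigen_extends[rotated])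
  fix f :: "(nat \<times> nat \<Rightarrow> 'l) \<Rightarrow> 'l"
  assume f: "weakly_polynomial a (coords d n) (Xn d n) f"
    and "\<forall>\<kappa>\<in>{..<n} \<times> {1..<d}. \<exists>e\<le>2 * a. eigen_along d n f \<kappa> e"
  then obtain e0 where e0: "\<And>\<kappa>. \<kappa> \<in> {..<n} \<times> {1..<d} \<Longrightarrow> e0 \<kappa> \<le> 2 * a \<and> eigen_along d n f \<kappa> (e0 \<kappa>)"
    by metis
  \<comment> \<open>Column \<open>0\<close> is the reference, with weight \<open>0\<close> and
    therefore shifted exponent \<open>a\<close>.\<close>
  define e where "e = (\<lambda>x. if snd x = 0 then a else e0 x)"
  define b where "b i = arg_min_on (\<lambda>j. e (i, j)) {..<d}" for i
  \<comment> \<open>Subtracting the row minimum makes the weights natural numbers; by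
    \<open>min\<close> no truncation occurs in columns below \<open>d\<close>.\<close>
  define \<theta> where "\<theta> x = e x - e (fst x, b (fst x))" for x
  have ne: "{..<d} \<noteq> {}" using d by (auto simp: lessThan_empty_iff bot_nat_def)
  have b: "b i < d" for i
    using arg_min_if_finite(1)[of "{..<d}" "\<lambda>j. e (i, j)"] ne by (auto simp: b_def)
  have min: "e (i, b i) \<le> e (i, j)" if "j < d" for i j
    using arg_min_least[of "{..<d}" j "\<lambda>j. e (i, j)"] ne that by (auto simp: b_def)
  have e_le: "e (i, j) \<le> 2 * a" if "i < n" "j < d" for i j
    using e0[of "(i, j)"] that by (auto simp: e_def)
  have e_0: "e (i, 0) = a" for i by (simp add: e_def)
  interpret eigenfunction a C d n f \<theta> b
  proof
    show "weakly_polynomial a (coords d n) (Xn d n) f" by (rule f)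
    show "b i < d" for i by (rule b)
    show "\<theta> (i, b i) = 0" for i by (simp add: \<theta>_def)
    show "\<theta> (i, 0) \<le> a" for i by (simp add: \<theta>_def e_0)
    show "\<theta> (i, j) \<le> \<theta> (i, 0) + a" if "i < n" "j < d" for i j
      using e_le[OF that] min[of 0 i] d by (simp add: \<theta>_def e_0)
    show "f (act t v) = (\<Prod>x\<in>coords d n. t x ^ \<theta> x) * f v"
      if "v \<in> Xn d n" "\<And>i. i < n \<Longrightarrow> (\<Prod>j<d. t (i, j)) = 1" for v t
    proof (rule eigen_act[OF d, where e = e and c = "\<lambda>i. e (i, b i)"])
      show "eigen_along d n f \<kappa> (e \<kappa>)" if "\<kappa> \<in> {..<n} \<times> {1..<d}" for \<kappa>
        using e0[OF that] that by (auto simp: e_def)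
      show "e (i, j) = \<theta> (i, j) + e (i, b i)" if "i < n" "j < d" for i j
        using min[OF that(2), of i] by (simp add: \<theta>_def)
    qed (use that e_0 in auto)
  qed
  show "extends d n f" by (rule extends_eigenfunction[OF d])
qed

subsection \<open>The hypersurface over a finite extension\<close>

text \<open>The coefficients of \<open>Pn\<close> are sums of ones, so \<open>emb\<close> carries
  the defining polynomial to the same expression over the larger field.\<close>

lemma hypersurface_points_Pn:
  fixes emb :: "'k::field \<Rightarrow> 'l::field"
  assumes "emb 1 = 1" "\<And>x y. emb (x + y) = emb x + emb y"
  shows "hypersurface_points emb (coords d n) (Pn d n) = Xn d n"
proof -
  have emb0: "emb 0 = 0" by (metis assms(2) add_0 add_cancel_right_right)
  have lookup_map: "Poly_Mapping.lookup (Poly_Mapping.map emb p) m = emb (Poly_Mapping.lookup p m)" for p :: "(nat \<times> nat, 'k) mpoly" and m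
    by (auto simp: map.rep_eq when_def emb0)
  have "emb (\<Sum>x\<in>A. h x) = (\<Sum>x\<in>A. emb (h x))" for A and h :: "nat \<Rightarrow> 'k"
    by (induction A rule: infinite_finite_induct) (auto simp: emb0 assms(2))
  then have "Poly_Mapping.map emb (Pn d n) =
      (\<Sum>i<n. Poly_Mapping.single (\<Sum>j<d. Poly_Mapping.single (i, j) 1) 1)"
    unfolding Pn_conv_single
    by (intro poly_mapping_eqI) (auto simp: lookup_map lookup_sum lookup_single when_def emb0 assms(1) intro!: sum.cong)
  moreover have "mpoly_eval v (Poly_Mapping.single (\<Sum>j<d. Poly_Mapping.single (i, j) 1) 1) = (\<Prod>j<d. v (i, j))"
    for v :: "nat \<times> nat \<Rightarrow> 'l" and i
  proof -
    let ?m = "\<Sum>j<d. Poly_Mapping.single (i, j) (1::nat)"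
    have k: "Poly_Mapping.keys ?m \<subseteq> Pair i ` {..<d}"
      by (rule order_trans[OF keys_sum_subset]) auto
    have l: "Poly_Mapping.lookup ?m (i, j) = 1" if "j < d" for j
      using that by (simp add: lookup_sum lookup_single when_def)
    have "mpoly_eval v (Poly_Mapping.single ?m 1) = (\<Prod>x\<in>Pair i ` {..<d}. v x ^ Poly_Mapping.lookup ?m x)"
      unfolding mpoly_eval_single by (subst monom_eval_superset[OF _ k]) auto
    also have "\<dots> = (\<Prod>j<d. v (i, j))"
      by (subst prod.reindex) (auto simp: inj_on_def l[simplified] intro!: prod.cong)
    finally show ?thesis .
  qed
  ultimately show ?thesis
    unfolding hypersurface_points_def Xn_def by (simp add: mpoly_eval_sum)
qed

text \<open>A field homomorphism is injective, and the powers of \<open>z\<close> below its order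
  are distinct. For \<open>m > 2 * a\<close> their images supply the nonzero points demanded by
  \<open>large_field\<close>.\<close>

lemma root_of_unity_powers:
  fixes emb :: "'k::field \<Rightarrow> 'l::field"
  assumes emb: "emb 1 = 1" "\<And>x y. emb (x + y) = emb x + emb y" "\<And>x y. emb (x * y) = emb x * emb y"
    and z: "root_of_unity_of_order m z"
  shows "card ((\<lambda>i. emb (z ^ i)) ` {..<m}) = m" "0 \<notin> (\<lambda>i. emb (z ^ i)) ` {..<m}"
proof -
  have emb0: "emb 0 = 0" by (metis emb(2) add_0 add_cancel_right_right)
  have z0: "z \<noteq> 0" using z by (auto simp: root_of_unity_of_order_def power_0_left)
  have nz: "emb x \<noteq> 0" if "x \<noteq> 0" for x
  proof
    assume "emb x = 0"
    then have "emb (x * (1 / x)) = 0" unfolding emb(3) by simp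
    then show False using that emb(1) by simp
  qed
  have inj: "x = y" if "emb x = emb y" for x y
  proof (rule ccontr)
    assume "x \<noteq> y"
    then have "emb (x - y) \<noteq> 0" by (intro nz) simp
    moreover have "emb x = emb (x - y) + emb y" using emb(2)[of "x - y" y] by simp
    ultimately show False using that by simp
  qed
  have ne: "z ^ i \<noteq> z ^ j" if "i < j" "j < m" for i j
  proof
    assume "z ^ i = z ^ j"
    moreover have "z ^ j = z ^ i * z ^ (j - i)" using that(1) by (simp flip: power_add)
    ultimately have "z ^ i * z ^ (j - i) = z ^ i * 1" by simp
    then have "z ^ (j - i) = 1" using z0 by simp
    then show False using z that by (auto simp: root_of_unity_of_order_def)
  qed
  have "inj_on (\<lambda>i. emb (z ^ i)) {..<m}"
  proof (rule inj_onI)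
    fix i j assume "i \<in> {..<m}" "j \<in> {..<m}" "emb (z ^ i) = emb (z ^ j)"
    then show "i = j" using inj ne by (metis lessThan_iff linorder_neqE_nat)
  qed
  then show "card ((\<lambda>i. emb (z ^ i)) ` {..<m}) = m" by (simp add: card_image)
  show "0 \<notin> (\<lambda>i. emb (z ^ i)) ` {..<m}" using nz z0 by force
qed

theorem theorem1p9:
  fixes a d n :: nat
  assumes "a \<ge> 1" and "d \<ge> 1" and "n \<ge> 1"
    and "admissible TYPE('k::field) a d"
  shows "ereal_of_enat (poly_rank (coords d n) (Pn d n :: (nat \<times> nat, 'k) mpoly)) \<ge> ereal (real n / real d)
       \<and> star_property TYPE('l::field) a (coords d n) (Pn d n :: (nat \<times> nat, 'k) mpoly)"
proof
  show "ereal_of_enat (poly_rank (coords d n) (Pn d n :: (nat \<times> nat, 'k) mpoly)) \<ge> ereal (real n / real d)"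
    using assms(2,3) by (rule poly_rank_Pn_ge)
  show "star_property TYPE('l) a (coords d n) (Pn d n :: (nat \<times> nat, 'k) mpoly)"
    unfolding star_property_def
  proof (intro allI impI)
    fix emb :: "'k \<Rightarrow> 'l" and f
    assume emb: "finite_field_extension emb"
      and f: "weakly_polynomial a (coords d n) (hypersurface_points emb (coords d n) (Pn d n)) f"
    have hom: "emb 1 = 1" "\<And>x y. emb (x + y) = emb x + emb y" "\<And>x y. emb (x * y) = emb x * emb y"
      using emb by (auto simp: finite_field_extension_def)
    obtain m and z :: 'k where z: "m > 2 * a" "root_of_unity_of_order m z"
      using assms(4) by (auto simp: admissible_def)
    obtain C where C: "C \<subseteq> (\<lambda>i. emb (z ^ i)) ` {..<m}" "card C = Suc (2 * a)"
      using root_of_unity_powers(1)[OF hom z(2)] z(1) by (metis Suc_leI obtain_subset_with_card_n)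
    interpret large_field a C
      using C root_of_unity_powers(2)[OF hom z(2)] by unfold_locales (auto intro: finite_subset)
    have "extends d n f"
      using assms(2) f unfolding hypersurface_points_Pn[OF hom(1,2)] by (rule weakly_polynomial_extends)
    then show "\<exists>g. polynomial_on a (coords d n) (affine_points (coords d n)) g \<and>
        (\<forall>v\<in>hypersurface_points emb (coords d n) (Pn d n). f v = g v)"
      unfolding hypersurface_points_Pn[OF hom(1,2)] extends_def .
  qed
qed

end
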